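(* Let $k$ be a field and let $I\subseteq R=k[x_1,\ldots,x_n]$ be a nonzero $C$-matroidal ideal with $\operatorname{ht} I=c$. Then $$\widehat\alpha(I)=\min_{1\le\ell\le c}\left\{\frac{\alpha(SF_\ell(I))}{\ell}\right\}.$$ Write $I=I_\Delta=J(\Delta^* )$ for a matroid $\Delta$ on $[n]$ with dual matroid $\Delta^*$. Then, additionally: (1) letting $c_h$ denote the smallest size of a circuit in the elongation of $\Delta$ to rank $n-c+h-1$, for $1\le h\le c$, one has for every $\ell\ge1$ $$\alpha(I^{(\ell)})=\min\left\{\sum_{h=1}^c a_hc_h \;\middle|\; a_h\in\mathbb Z_{\ge0},\ \sum_{h=1}^c h a_h=\ell\right\},\qquad\text{and}\qquad \widehat\alpha(I)=\min\left\{\frac{c_h}{h} \;\middle|\; h=1,\ldots,c\right\};$$ (2) letting $f_h$ denote the largest size of a flat of $\Delta^*$ of rank $h$, for $0\le h\le c-1$, one has for every $\ell\ge1$ $$\alpha(I^{(\ell)})=\min\left\{\sum_{h=0}^{c-1} a_h(n-f_h) \;\middle|\; a_h\in\mathbb Z_{\ge0},\ \sum_{h=0}^{c-1}(c-h)a_h=\ell\right\},\qquad\text{and}\qquad \widehat\alpha(I)=\min\left\{\frac{n-f_h}{c-h} \;\middle|\; h=0,\ldots,c-1\right\}.$$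
   Context: A matroid on $[n]$ is identified with the simplicial complex whose facets are its bases (loops allowed). For $F\subseteq[n]$, $\mathfrak p_F=(x_i:i\in F)$. For a matroid $\Delta$, $I_\Delta=\bigcap_{F}\mathfrak p_{[n]-F}$ is its Stanley--Reisner ideal and $J(\Delta)=\bigcap_F\mathfrak p_F$ its cover ideal (intersections over the bases $F$); $I_\Delta=J(\Delta^* )$. A squarefree monomial ideal is $C$-matroidal if it is $I_\Delta$ for some matroid $\Delta$ on $[n]$. If $\operatorname{ht} I_\Delta=c$, then $\Delta$ has rank $n-c$ and $\Delta^*$ has rank $c$. For a squarefree monomial ideal $I$, $I^{(\ell)}=\bigcap_{\mathfrak p\in\operatorname{Ass}(R/I)}\mathfrak p^\ell$, and $SF_\ell(I)$ is the ideal generated by all squarefree monomials in $I^{(\ell)}$. For a nonzero homogeneous ideal $L$, $\alpha(L)$ is the smallest degree of a nonzero element of $L$, and the Waldschmidt constant is $\widehat\alpha(I)=\lim_{\ell\to\infty}\alpha(I^{(\ell)})/\ell$. The elongation of $\Delta$ (with rank function $r$) to rank $r(\Delta)+h$ is the matroid on $[n]$ whose independent sets are the $H\subseteq[n]$ with $|H|-r(H)\le h$. *)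

theory Defs
  imports
    Complex_Main
    "HOL-Library.Poly_Mapping"
    "HOL-Library.Extended_Nat"
    "HOL-Library.Cardinality"
begin

section \<open>Matroids\<close>

text \<open>
  The ground set $[n]$ is a finite type \<open>'n\<close>, so $n$ is \<open>CARD('n)\<close>. A matroid is the simplicial
  complex of its independent sets. Loops are allowed: singletons need not be independent.
\<close>

definition matroid :: "'n::finite set set \<Rightarrow> bool" where
  "matroid \<Delta> \<longleftrightarrow>
     {} \<in> \<Delta> \<and>
     (\<forall>X Y. Y \<in> \<Delta> \<longrightarrow> X \<subseteq> Y \<longrightarrow> X \<in> \<Delta>) \<and>
     (\<forall>X\<in>\<Delta>. \<forall>Y\<in>\<Delta>. card X < card Y \<longrightarrow> (\<exists>y\<in>Y - X. insert y X \<in> \<Delta>))"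

definition bases :: "'n::finite set set \<Rightarrow> 'n set set" where
  "bases \<Delta> = {B \<in> \<Delta>. \<forall>Y\<in>\<Delta>. B \<subseteq> Y \<longrightarrow> Y = B}"

definition matroid_rank :: "'n::finite set set \<Rightarrow> 'n set \<Rightarrow> nat" where
  "matroid_rank \<Delta> X = Max (card ` {Y \<in> \<Delta>. Y \<subseteq> X})"

definition dual_matroid :: "'n::finite set set \<Rightarrow> 'n set set" where
  "dual_matroid \<Delta> = {Y. \<exists>B\<in>bases \<Delta>. Y \<subseteq> - B}"

definition circuits :: "'n::finite set set \<Rightarrow> 'n set set" where
  "circuits \<Delta> = {C. C \<notin> \<Delta> \<and> (\<forall>X. X \<subset> C \<longrightarrow> X \<in> \<Delta>)}"

definition flats :: "'n::finite set set \<Rightarrow> 'n set set" where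
  "flats \<Delta> = {F. \<forall>x. x \<notin> F \<longrightarrow> matroid_rank \<Delta> F < matroid_rank \<Delta> (insert x F)}"

text \<open>
  The second argument is the rank of the elongation, not the amount by which the rank is raised.
  It is only meaningful if it lies between the rank of the matroid and the size of the ground set.
\<close>

definition elongation :: "'n::finite set set \<Rightarrow> nat \<Rightarrow> 'n set set" where
  "elongation \<Delta> s = {H. card H - matroid_rank \<Delta> H \<le> s - matroid_rank \<Delta> UNIV}"

definition min_circuit_size :: "'n::finite set set \<Rightarrow> nat" where
  "min_circuit_size \<Delta> = Min (card ` circuits \<Delta>)"

definition max_flat_size :: "'n::finite set set \<Rightarrow> nat \<Rightarrow> nat" where
  "max_flat_size \<Delta> h = Max (card ` {F \<in> flats \<Delta>. matroid_rank \<Delta> F = h})"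


section \<open>Ideals in commutative rings\<close>

text \<open>
  An ideal is a submodule of the ring over itself: \<open>ideal.subspace\<close> is the predicate of being an
  ideal and \<open>ideal.span\<close> is the ideal generated by a set.
\<close>

global_interpretation ideal: module "(*) :: 'a::comm_ring_1 \<Rightarrow> 'a \<Rightarrow> 'a"
  by unfold_locales (simp_all add: algebra_simps)

definition prime_ideal :: "'a::comm_ring_1 set \<Rightarrow> bool" where
  "prime_ideal P \<longleftrightarrow>
     ideal.subspace P \<and> P \<noteq> UNIV \<and> (\<forall>a b. a * b \<in> P \<longrightarrow> a \<in> P \<or> b \<in> P)"

primrec ideal_power :: "'a::comm_ring_1 set \<Rightarrow> nat \<Rightarrow> 'a set" where
  "ideal_power I 0 = UNIV"
| "ideal_power I (Suc l) = ideal.span {a * b | a b. a \<in> I \<and> b \<in> ideal_power I l}"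

definition prime_height :: "'a::comm_ring_1 set \<Rightarrow> enat" where
  "prime_height P =
     Sup {enat m | m. \<exists>Q :: nat \<Rightarrow> 'a set.
            (\<forall>i\<le>m. prime_ideal (Q i)) \<and> (\<forall>i<m. Q i \<subset> Q (Suc i)) \<and> Q m = P}"

definition ideal_height :: "'a::comm_ring_1 set \<Rightarrow> enat" where
  "ideal_height I = Inf (prime_height ` {P. prime_ideal P \<and> I \<subseteq> P})"

text \<open>
  The associated primes of the quotient module $R/I$: the annihilator of the class of \<open>f\<close> is
  \<open>{g. g * f \<in> I}\<close>.
\<close>

definition Ass_quotient :: "'a::comm_ring_1 set \<Rightarrow> 'a set set" where
  "Ass_quotient I = {P. prime_ideal P \<and> (\<exists>f. P = {g. g * f \<in> I})}"

definition symbolic_power :: "'a::comm_ring_1 set \<Rightarrow> nat \<Rightarrow> 'a set" where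
  "symbolic_power I l = (\<Inter>P\<in>Ass_quotient I. ideal_power P l)"


section \<open>Squarefree monomial ideals in the polynomial ring\<close>

text \<open>Monomials are exponent vectors \<open>'n \<Rightarrow>\<^sub>0 nat\<close>; multiplication of polynomials is convolution.\<close>

type_synonym ('n, 'k) mpoly = "('n \<Rightarrow>\<^sub>0 nat) \<Rightarrow>\<^sub>0 'k"

definition monomial :: "('n \<Rightarrow>\<^sub>0 nat) \<Rightarrow> ('n, 'k::field) mpoly" where
  "monomial m = Poly_Mapping.single m 1"

definition var :: "'n \<Rightarrow> ('n, 'k::field) mpoly" where
  "var i = monomial (Poly_Mapping.single i 1)"

definition squarefree_monomial :: "('n, 'k::field) mpoly \<Rightarrow> bool" where
  "squarefree_monomial f \<longleftrightarrow> (\<exists>m. f = monomial m \<and> (\<forall>i. Poly_Mapping.lookup m i \<le> 1))"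

definition squarefree_monomial_ideal :: "('n, 'k::field) mpoly set \<Rightarrow> bool" where
  "squarefree_monomial_ideal I \<longleftrightarrow> (\<exists>S. (\<forall>f\<in>S. squarefree_monomial f) \<and> I = ideal.span S)"

definition total_degree :: "('n::finite, 'k::field) mpoly \<Rightarrow> nat" where
  "total_degree f = Max ((\<lambda>m. \<Sum>i\<in>UNIV. Poly_Mapping.lookup m i) ` Poly_Mapping.keys f)"

text \<open>On a nonzero homogeneous ideal this is the initial degree.\<close>

definition alpha :: "('n::finite, 'k::field) mpoly set \<Rightarrow> nat" where
  "alpha L = (LEAST d. \<exists>f\<in>L. f \<noteq> 0 \<and> total_degree f = d)"

definition waldschmidt :: "('n::finite, 'k::field) mpoly set \<Rightarrow> real" where
  "waldschmidt I = lim (\<lambda>l. real (alpha (symbolic_power I l)) / real l)"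

definition SF :: "nat \<Rightarrow> ('n, 'k::field) mpoly set \<Rightarrow> ('n, 'k) mpoly set" where
  "SF l I = ideal.span {f \<in> symbolic_power I l. squarefree_monomial f}"

definition var_ideal :: "'n set \<Rightarrow> ('n, 'k::field) mpoly set" where
  "var_ideal F = ideal.span (var ` F)"

definition stanley_reisner_ideal :: "'n::finite set set \<Rightarrow> ('n, 'k::field) mpoly set" where
  "stanley_reisner_ideal \<Delta> = (\<Inter>F\<in>bases \<Delta>. var_ideal (- F))"

definition cover_ideal :: "'n::finite set set \<Rightarrow> ('n, 'k::field) mpoly set" where
  "cover_ideal \<Delta> = (\<Inter>F\<in>bases \<Delta>. var_ideal F)"

definition C_matroidal :: "('n::finite, 'k::field) mpoly set \<Rightarrow> bool" where
  "C_matroidal I \<longleftrightarrow>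
     squarefree_monomial_ideal I \<and> (\<exists>\<Delta>. matroid \<Delta> \<and> I = stanley_reisner_ideal \<Delta>)"

end

theory Submission
  imports Defs "HOL-Library.FuncSet"
begin

text \<open>
  An exponent vector lies in the \<open>l\<close>-th symbolic power iff it has weight at least \<open>l\<close> off every
  basis. By the greedy algorithm one basis meets all level sets \<open>U\<^sub>t\<close> of the vector in maximal
  independent subsets, so the least such weight is the sum of the nullities \<open>card U\<^sub>t - r(U\<^sub>t)\<close>.
  Hence the initial degree is governed by the least sizes \<open>s\<^sub>h\<close> of sets of nullity \<open>h\<close>: a vector
  yields a decomposition of \<open>l\<close> into nullities, and conversely indicator vectors of minimal sets may
  be added up. These minimal sets are the smallest circuits of the elongations and, by
  \<open>r\<^sup>*(- U) = c - (card U - r(U))\<close>, the complements of the largest flats of the dual.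
\<close>

section \<open>Rank and nullity\<close>

text \<open>Everything turns on one sequence, \<open>min_nullity_size \<Delta> h\<close>. Nullity is
  monotone and drops by at most one when an element is removed, so a smallest set of nullity at
  least \<open>h\<close> has nullity exactly \<open>h\<close>; this lets the elongations, the dual
  flats and the ideals \<open>SF\<close> all be read off the same numbers. A vector only yields a
  total nullity of at least \<open>l\<close>, while the formulas ask for exactly \<open>l\<close>;
  monotonicity of the sequence allows the surplus to be cut away.

  The algebraic obstacle is the parameter \<open>c\<close>. It is given as a height, defined through
  arbitrary chains of arbitrary primes, but the combinatorics needs it to be
  \<open>nullity \<Delta> UNIV\<close>, the common size of the complements of the bases. The lower
  bound is a chain of variable ideals; the upper bound is a dimension count over the field, in place
  of Krull's height theorem. Symbolic powers likewise start from annihilator primes, so these must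
  first be shown to be the ideals \<open>var_ideal (- B)\<close>.\<close>

lemma matroid_empty: "matroid \<Delta> \<Longrightarrow> {} \<in> \<Delta>"
  by (simp add: matroid_def)

lemma matroid_subset: "matroid \<Delta> \<Longrightarrow> Y \<in> \<Delta> \<Longrightarrow> X \<subseteq> Y \<Longrightarrow> X \<in> \<Delta>"
  unfolding matroid_def by blast

lemma matroid_augment:
  "matroid \<Delta> \<Longrightarrow> X \<in> \<Delta> \<Longrightarrow> Y \<in> \<Delta> \<Longrightarrow> card X < card Y \<Longrightarrow> \<exists>y\<in>Y - X. insert y X \<in> \<Delta>"
  unfolding matroid_def by blast

lemma card_le_matroid_rank:
  fixes \<Delta> :: "'n::finite set set"
  shows "Y \<in> \<Delta> \<Longrightarrow> Y \<subseteq> X \<Longrightarrow> card Y \<le> matroid_rank \<Delta> X"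
  unfolding matroid_rank_def by (intro Max_ge) auto

lemma matroid_rank_witness:
  fixes \<Delta> :: "'n::finite set set"
  assumes "matroid \<Delta>"
  obtains Y where "Y \<in> \<Delta>" "Y \<subseteq> X" "card Y = matroid_rank \<Delta> X"
proof -
  have "matroid_rank \<Delta> X \<in> card ` {Y \<in> \<Delta>. Y \<subseteq> X}"
    unfolding matroid_rank_def using matroid_empty[OF assms] by (intro Max_in) auto
  then show ?thesis using that by auto
qed

lemma matroid_rank_le_card:
  fixes \<Delta> :: "'n::finite set set"
  assumes "matroid \<Delta>" shows "matroid_rank \<Delta> X \<le> card X"
  using matroid_rank_witness[OF assms, of X] by (metis card_mono finite)

text \<open>While \<open>X\<close> is smaller than a largest independent subset of \<open>U\<close>,
  augmentation takes a new element from that subset, hence never leaves \<open>U\<close>.\<close>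

lemma independent_extend:
  fixes \<Delta> :: "'n::finite set set"
  assumes M: "matroid \<Delta>" and "X \<in> \<Delta>" "X \<subseteq> U"
  obtains Y where "Y \<in> \<Delta>" "X \<subseteq> Y" "Y \<subseteq> U" "card Y = matroid_rank \<Delta> U"
proof -
  have "\<exists>Y\<in>\<Delta>. X \<subseteq> Y \<and> Y \<subseteq> U \<and> card Y = matroid_rank \<Delta> U" using assms(2,3)
  proof (induction "matroid_rank \<Delta> U - card X" arbitrary: X rule: less_induct)
    case less
    show ?case
    proof (cases "card X = matroid_rank \<Delta> U")
      case True
      with less.prems show ?thesis by blast
    next
      case False
      with card_le_matroid_rank[OF less.prems] have lt: "card X < matroid_rank \<Delta> U" by simp
      obtain Z where Z: "Z \<in> \<Delta>" "Z \<subseteq> U" "card Z = matroid_rank \<Delta> U"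
        using matroid_rank_witness[OF M] .
      obtain y where y: "y \<in> Z - X" "insert y X \<in> \<Delta>"
        using matroid_augment[OF M less.prems(1) Z(1)] lt Z(3) by auto
      have "card (insert y X) = Suc (card X)" using y(1) by simp
      moreover have "insert y X \<subseteq> U" using y(1) Z(2) less.prems(2) by blast
      ultimately have "\<exists>Y\<in>\<Delta>. insert y X \<subseteq> Y \<and> Y \<subseteq> U \<and> card Y = matroid_rank \<Delta> U"
        using less.hyps[of "insert y X"] y(2) lt by (simp add: diff_less_mono2)
      then show ?thesis by auto
    qed
  qed
  then show ?thesis using that by blast
qed

lemma bases_iff:
  fixes \<Delta> :: "'n::finite set set"
  assumes M: "matroid \<Delta>"
  shows "B \<in> bases \<Delta> \<longleftrightarrow> B \<in> \<Delta> \<and> card B = matroid_rank \<Delta> UNIV"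
proof
  assume B: "B \<in> bases \<Delta>"
  then have "B \<in> \<Delta>" by (simp add: bases_def)
  then obtain Y where "Y \<in> \<Delta>" "B \<subseteq> Y" "card Y = matroid_rank \<Delta> UNIV"
    using independent_extend[OF M, of B UNIV] by auto
  with B show "B \<in> \<Delta> \<and> card B = matroid_rank \<Delta> UNIV" by (auto simp: bases_def)
next
  assume B: "B \<in> \<Delta> \<and> card B = matroid_rank \<Delta> UNIV"
  have "Y = B" if "Y \<in> \<Delta>" "B \<subseteq> Y" for Y
    using card_le_matroid_rank[OF that(1), of UNIV] B that(2) card_seteq[of Y B] by simp
  with B show "B \<in> bases \<Delta>" by (auto simp: bases_def)
qed

lemma card_Int_basis_le:
  fixes \<Delta> :: "'n::finite set set"
  assumes "matroid \<Delta>" "B \<in> bases \<Delta>"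
  shows "card (U \<inter> B) \<le> matroid_rank \<Delta> U"
  using assms card_le_matroid_rank[of "U \<inter> B" \<Delta> U] matroid_subset[of \<Delta> B "U \<inter> B"]
  by (simp add: bases_iff)

text \<open>Greedy construction, starting inside the smallest set \<open>U T\<close> and extending
  up to \<open>U 0\<close>. Enlarging an independent set cannot spoil an equality already reached:
  its intersection with \<open>U t\<close> only grows, yet stays independent and so is capped by the
  rank. As \<open>U 0\<close> is everything, the final set is a basis.\<close>

lemma basis_chain:
  fixes \<Delta> :: "'n::finite set set"
  assumes M: "matroid \<Delta>" and dec: "\<And>s t. s \<le> t \<Longrightarrow> U t \<subseteq> U s" and U0: "U 0 = UNIV"
  obtains B where "B \<in> bases \<Delta>" "\<And>t. t \<le> (T::nat) \<Longrightarrow> card (U t \<inter> B) = matroid_rank \<Delta> (U t)"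
proof -
  \<comment> \<open>\<open>T - d\<close> is the lowest level treated so far, so the induction on
    \<open>d\<close> runs downwards from \<open>T\<close>.\<close>
  have "\<exists>Y\<in>\<Delta>. Y \<subseteq> U (T - d) \<and>
      (\<forall>t. T - d \<le> t \<longrightarrow> t \<le> T \<longrightarrow> card (U t \<inter> Y) = matroid_rank \<Delta> (U t))" if "d \<le> T" for d
    using that
  proof (induction d)
    case 0
    obtain Y where "Y \<in> \<Delta>" "Y \<subseteq> U T" "card Y = matroid_rank \<Delta> (U T)"
      using matroid_rank_witness[OF M] .
    then show ?case by (auto simp: Int_absorb1 intro!: bexI[of _ Y])
  next
    case (Suc d)
    then obtain Y where Y: "Y \<in> \<Delta>" "Y \<subseteq> U (T - d)"
      "\<And>t. T - d \<le> t \<Longrightarrow> t \<le> T \<Longrightarrow> card (U t \<inter> Y) = matroid_rank \<Delta> (U t)" by auto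
    let ?s = "T - Suc d"
    have "Y \<subseteq> U ?s" using Y(2) dec[of ?s "T - d"] by (simp add: diff_le_mono2 subset_trans)
    then obtain Z where Z: "Z \<in> \<Delta>" "Y \<subseteq> Z" "Z \<subseteq> U ?s" "card Z = matroid_rank \<Delta> (U ?s)"
      using independent_extend[OF M Y(1)] by blast
    have "card (U t \<inter> Z) = matroid_rank \<Delta> (U t)" if t: "?s \<le> t" "t \<le> T" for t
    proof (cases "t = ?s")
      case True
      then show ?thesis using Z by (simp add: Int_absorb1)
    next
      case False
      then have "matroid_rank \<Delta> (U t) = card (U t \<inter> Y)" using Y(3)[of t] t Suc.prems by simp
      also have "\<dots> \<le> card (U t \<inter> Z)" using Z(2) by (intro card_mono) auto
      finally show ?thesis
        using card_le_matroid_rank[of "U t \<inter> Z" \<Delta> "U t"] matroid_subset[OF M Z(1)] by auto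
    qed
    then show ?case using Z by blast
  qed
  from this[of T] obtain Y where Y: "Y \<in> \<Delta>"
    "\<And>t. t \<le> T \<Longrightarrow> card (U t \<inter> Y) = matroid_rank \<Delta> (U t)" by auto
  have "Y \<in> bases \<Delta>" using Y(2)[of 0] Y(1) by (simp add: U0 bases_iff[OF M])
  then show ?thesis using that Y(2) by blast
qed

lemma basis_rank_witness:
  fixes \<Delta> :: "'n::finite set set"
  assumes M: "matroid \<Delta>"
  obtains B where "B \<in> bases \<Delta>" "card (U \<inter> B) = matroid_rank \<Delta> U"
proof -
  obtain X where X: "X \<in> \<Delta>" "X \<subseteq> U" "card X = matroid_rank \<Delta> U"
    using matroid_rank_witness[OF M] .
  obtain B where B: "B \<in> \<Delta>" "X \<subseteq> B" "card B = matroid_rank \<Delta> UNIV"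
    using independent_extend[OF M X(1), of UNIV] by auto
  have "B \<in> bases \<Delta>" using B by (simp add: bases_iff[OF M])
  moreover have "card X \<le> card (U \<inter> B)" using X B by (intro card_mono) auto
  ultimately show ?thesis
    using that card_Int_basis_le[OF M, of B U] X(3) by (metis le_antisym)
qed

text \<open>Equivalently the least number of elements of \<open>U\<close> left uncovered by a basis,
  see \<open>nullity_le_card_Diff_basis\<close> and \<open>basis_rank_witness\<close>; this is how
  weights off a basis enter. The truncated subtraction loses nothing by
  \<open>matroid_rank_le_card\<close>.\<close>

definition nullity :: "'n::finite set set \<Rightarrow> 'n set \<Rightarrow> nat" where
  "nullity \<Delta> U = card U - matroid_rank \<Delta> U"

lemma card_Diff_basis: "card (U - B) = card U - card (U \<inter> B)" for B :: "'n::finite set"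
  by (simp add: card_Diff_subset_Int)

lemma nullity_le_card_Diff_basis:
  assumes "matroid \<Delta>" "B \<in> bases \<Delta>"
  shows "nullity \<Delta> U \<le> card (U - B)"
  using card_Int_basis_le[OF assms, of U] by (simp add: nullity_def card_Diff_basis)

lemma matroid_rank_Un_le:
  assumes "matroid \<Delta>"
  shows "matroid_rank \<Delta> (U \<union> W) \<le> matroid_rank \<Delta> U + card W"
proof -
  obtain Y where Y: "Y \<in> \<Delta>" "Y \<subseteq> U \<union> W" "card Y = matroid_rank \<Delta> (U \<union> W)"
    using matroid_rank_witness[OF assms] .
  have "card Y \<le> card ((Y \<inter> U) \<union> W)" using Y(2) by (intro card_mono) auto
  also have "\<dots> \<le> card (Y \<inter> U) + card W" by (rule card_Un_le)
  also have "card (Y \<inter> U) \<le> matroid_rank \<Delta> U"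
    using matroid_subset[OF assms Y(1)] by (intro card_le_matroid_rank) auto
  finally show ?thesis using Y(3) by simp
qed

lemma matroid_rank_mono:
  assumes "matroid \<Delta>" "U \<subseteq> V" shows "matroid_rank \<Delta> U \<le> matroid_rank \<Delta> V"
  using matroid_rank_witness[OF assms(1), of U] card_le_matroid_rank assms(2) by (metis subset_trans)

lemma nullity_mono:
  assumes M: "matroid \<Delta>" and "U \<subseteq> V" shows "nullity \<Delta> U \<le> nullity \<Delta> V"
proof -
  have "matroid_rank \<Delta> V \<le> matroid_rank \<Delta> U + card (V - U)"
    using matroid_rank_Un_le[OF M, of U "V - U"] assms(2) by (simp add: Un_absorb1)
  moreover have "card V = card U + card (V - U)"
    using assms(2) by (metis card_Diff_subset card_mono finite le_add_diff_inverse)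
  ultimately show ?thesis
    using matroid_rank_le_card[OF M, of U] by (simp add: nullity_def)
qed

lemma nullity_insert_le:
  assumes M: "matroid \<Delta>" shows "nullity \<Delta> (insert x U) \<le> Suc (nullity \<Delta> U)"
proof -
  have "matroid_rank \<Delta> U \<le> matroid_rank \<Delta> (insert x U)"
    by (rule matroid_rank_mono[OF M subset_insertI])
  moreover have "card (insert x U) \<le> Suc (card U)" by (simp add: card_insert_if)
  ultimately show ?thesis
    using matroid_rank_le_card[OF M, of U] unfolding nullity_def by arith
qed

lemma nullity_UNIV: "nullity \<Delta> (UNIV :: 'n::finite set) = CARD('n) - matroid_rank \<Delta> UNIV"
  by (simp add: nullity_def)

section \<open>Smallest sets of given nullity and the circuits of elongations\<close>

definition min_nullity_size :: "'n::finite set set \<Rightarrow> nat \<Rightarrow> nat" where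
  "min_nullity_size \<Delta> h = (LEAST d. \<exists>U. h \<le> nullity \<Delta> U \<and> card U = d)"

lemma min_nullity_size_le: "h \<le> nullity \<Delta> U \<Longrightarrow> min_nullity_size \<Delta> h \<le> card U"
  unfolding min_nullity_size_def by (rule Least_le) blast

text \<open>Nullity makes no jumps: if a smallest set had nullity above \<open>h\<close>, dropping
  one element would leave nullity at least \<open>h\<close> on a smaller set. The bound on
  \<open>h\<close> ensures that some set qualifies; beyond it the \<open>LEAST\<close> is
  unspecified.\<close>

lemma min_nullity_size_witness:
  assumes M: "matroid \<Delta>" and "h \<le> nullity \<Delta> UNIV"
  obtains U where "nullity \<Delta> U = h" "card U = min_nullity_size \<Delta> h"
proof -
  have "\<exists>U. h \<le> nullity \<Delta> U \<and> card U = min_nullity_size \<Delta> h"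
    unfolding min_nullity_size_def by (rule LeastI_ex) (use assms(2) in blast)
  then obtain U where U: "h \<le> nullity \<Delta> U" "card U = min_nullity_size \<Delta> h" by blast
  have "nullity \<Delta> U = h"
  proof (rule ccontr)
    assume "nullity \<Delta> U \<noteq> h"
    with U(1) have gt: "h < nullity \<Delta> U" by simp
    then have "U \<noteq> {}" by (auto simp: nullity_def)
    then obtain x where x: "x \<in> U" by blast
    have "h \<le> nullity \<Delta> (U - {x})"
      using nullity_insert_le[OF M, of x "U - {x}"] gt x by (simp add: insert_absorb)
    from min_nullity_size_le[OF this] U(2) x show False
      by (metis card_Diff1_less finite leD)
  qed
  with U(2) that show ?thesis by blast
qed

lemma min_nullity_size_mono:
  assumes M: "matroid \<Delta>" and "h \<le> k" "k \<le> nullity \<Delta> UNIV"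
  shows "min_nullity_size \<Delta> h \<le> min_nullity_size \<Delta> k"
  using min_nullity_size_witness[OF M assms(3)] assms(2) min_nullity_size_le by metis

text \<open>The independent sets of the elongation are those of nullity below \<open>h\<close>, so
  its circuits are the inclusion-minimal sets of nullity at least \<open>h\<close>. With
  \<open>1 \<le> h\<close> the truncated subtraction in \<open>elongation\<close> really yields
  \<open>h - 1\<close>.\<close>

lemma min_circuit_size_elongation:
  assumes M: "matroid \<Delta>" and h: "1 \<le> h" "h \<le> nullity \<Delta> UNIV"
  shows "min_circuit_size (elongation \<Delta> (matroid_rank \<Delta> UNIV + h - 1)) = min_nullity_size \<Delta> h"
proof -
  let ?E = "elongation \<Delta> (matroid_rank \<Delta> UNIV + h - 1)"
  have E: "H \<in> ?E \<longleftrightarrow> nullity \<Delta> H < h" for H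
    using h by (auto simp: elongation_def nullity_def)
  obtain U where U: "nullity \<Delta> U = h" "card U = min_nullity_size \<Delta> h"
    using min_nullity_size_witness[OF M h(2)] .
  \<comment> \<open>Smallest size forces minimality under inclusion, which is what a circuit asks
    for.\<close>
  have "nullity \<Delta> X < h" if "X \<subset> U" for X
    using min_nullity_size_le[of h \<Delta> X] U(2) psubset_card_mono[OF _ that] by force
  then have "U \<in> circuits ?E" using U(1) unfolding circuits_def mem_Collect_eq E by simp
  moreover have "min_nullity_size \<Delta> h \<le> card C" if "C \<in> circuits ?E" for C
    using that unfolding circuits_def mem_Collect_eq E by (simp add: min_nullity_size_le)
  ultimately show ?thesis
    unfolding min_circuit_size_def using U(2) by (intro Min_eqI) force+
qed

section \<open>Duality: complements of bases, dual rank, dual flats\<close>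

lemma bases_dual_matroid:
  assumes M: "matroid \<Delta>"
  shows "bases (dual_matroid \<Delta>) = uminus ` bases \<Delta>"
proof -
  have anti: "B = B'" if "B \<in> bases \<Delta>" "B' \<in> bases \<Delta>" "B' \<subseteq> B" for B B'
    using that by (auto simp: bases_def)
  have dual_iff: "Y \<in> dual_matroid \<Delta> \<longleftrightarrow> (\<exists>B\<in>bases \<Delta>. Y \<subseteq> - B)" for Y
    by (simp add: dual_matroid_def)
  show ?thesis
  proof (intro equalityI subsetI)
    fix X assume X: "X \<in> bases (dual_matroid \<Delta>)"
    then obtain B where B: "B \<in> bases \<Delta>" "X \<subseteq> - B" by (auto simp: bases_def dual_matroid_def)
    then have "- B \<in> dual_matroid \<Delta>" by (auto simp: dual_matroid_def)
    with X B(2) have "- B = X" unfolding bases_def by blast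
    with B(1) show "X \<in> uminus ` bases \<Delta>" by blast
  next
    fix X assume "X \<in> uminus ` bases \<Delta>"
    then obtain B where B: "B \<in> bases \<Delta>" "X = - B" by blast
    have "Y = X" if "B' \<in> bases \<Delta>" "Y \<subseteq> - B'" "X \<subseteq> Y" for Y B'
    proof -
      have "B' \<subseteq> B" using that(2,3) B(2) by blast
      from anti[OF B(1) that(1) this] show ?thesis using that(2,3) B(2) by blast
    qed
    then show "X \<in> bases (dual_matroid \<Delta>)"
      using B unfolding bases_def[of "dual_matroid \<Delta>"] mem_Collect_eq Ball_def dual_iff Bex_def
      by (metis subset_refl)
  qed
qed

text \<open>The dual rank of \<open>- U\<close> is the maximum of \<open>card (- U - B)\<close> over
  bases \<open>B\<close>. By \<open>card_eq\<close> this number differs from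
  \<open>card (U \<inter> B)\<close> only by a constant, so a basis meeting \<open>U\<close> in full
  rank attains it. The additive form avoids truncated subtraction.\<close>

lemma matroid_rank_dual:
  fixes \<Delta> :: "'n::finite set set"
  assumes M: "matroid \<Delta>"
  shows "matroid_rank (dual_matroid \<Delta>) (- U) + nullity \<Delta> U = nullity \<Delta> UNIV"
proof -
  let ?r = "matroid_rank \<Delta>"
  have card_eq: "card (- U - B) + ?r UNIV + card U = CARD('n) + card (U \<inter> B)" if "B \<in> bases \<Delta>" for B
  proof -
    have "CARD('n) = card ((- U - B) \<union> (B \<union> U))" by (rule arg_cong[of _ _ card]) auto
    also have "\<dots> = card (- U - B) + card (B \<union> U)" by (intro card_Un_disjoint) auto
    finally show ?thesis
      using card_Un_Int[of B U] that by (simp add: bases_iff[OF M] Int_commute)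
  qed
  have le: "card (- U - B) + ?r UNIV + card U \<le> CARD('n) + ?r U" if "B \<in> bases \<Delta>" for B
    using card_eq[OF that] card_Int_basis_le[OF M that, of U] by simp
  obtain B where B: "B \<in> bases \<Delta>" "card (U \<inter> B) = ?r U" using basis_rank_witness[OF M] .
  have "matroid_rank (dual_matroid \<Delta>) (- U) = card (- U - B)"
    unfolding matroid_rank_def
  proof (rule Max_eqI)
    show "card (- U - B) \<in> card ` {Y \<in> dual_matroid \<Delta>. Y \<subseteq> - U}"
      using B(1) by (auto simp: dual_matroid_def)
    fix y assume "y \<in> card ` {Y \<in> dual_matroid \<Delta>. Y \<subseteq> - U}"
    then obtain Y B' where Y: "y = card Y" "Y \<subseteq> - U - B'" "B' \<in> bases \<Delta>"
      by (auto simp: dual_matroid_def)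
    then have "y \<le> card (- U - B')" by (simp add: card_mono)
    with le[OF Y(3)] card_eq[OF B(1)] B(2) show "y \<le> card (- U - B)" by simp
  qed simp
  then show ?thesis
    using card_eq[OF B(1)] B(2) matroid_rank_le_card[OF M, of U] matroid_rank_le_card[OF M, of UNIV]
    by (simp add: nullity_def)
qed

text \<open>Complementation exchanges sets of nullity \<open>h\<close> with sets of dual rank
  \<open>c - h\<close>, where \<open>c\<close> is the nullity of the ground set, and so smallest
  with largest.\<close>

lemma max_flat_size_dual:
  fixes \<Delta> :: "'n::finite set set"
  assumes M: "matroid \<Delta>" and h: "h \<le> nullity \<Delta> UNIV"
  shows "max_flat_size (dual_matroid \<Delta>) (nullity \<Delta> UNIV - h) + min_nullity_size \<Delta> h = CARD('n)"
proof -
  let ?c = "nullity \<Delta> UNIV" and ?D = "dual_matroid \<Delta>"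
  have card_compl: "card X + card (- X) = CARD('n)" for X :: "'n set"
    using card_Un_disjoint[of X "- X"] by (simp add: Compl_partition)
  have null_compl: "nullity \<Delta> (- F) = h" if "matroid_rank ?D F = ?c - h" for F
    using matroid_rank_dual[OF M, of "- F"] that h by simp
  obtain U where U: "nullity \<Delta> U = h" "card U = min_nullity_size \<Delta> h"
    using min_nullity_size_witness[OF M h] .
  have rank: "matroid_rank ?D (- U) = ?c - h" using matroid_rank_dual[OF M, of U] U(1) by simp
  \<comment> \<open>Enlarging the complement by \<open>x\<close> removes \<open>x\<close> from
    \<open>U\<close>; by minimality this lowers the nullity, that is, it raises the dual
    rank.\<close>
  have "matroid_rank ?D (- U) < matroid_rank ?D (insert x (- U))" if "x \<notin> - U" for x
  proof -
    have "\<not> h \<le> nullity \<Delta> (U - {x})"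
      using min_nullity_size_le[of h \<Delta> "U - {x}"] U(2) that
      by (metis Compl_iff card_Diff1_less finite leD)
    moreover have "insert x (- U) = - (U - {x})" by auto
    ultimately show ?thesis
      using matroid_rank_dual[OF M, of U] matroid_rank_dual[OF M, of "U - {x}"] U(1) by simp
  qed
  then have "- U \<in> {F \<in> flats ?D. matroid_rank ?D F = ?c - h}" using rank by (simp add: flats_def)
  \<comment> \<open>This holds for every set of that dual rank, so in particular for the
    flats.\<close>
  moreover have "card F \<le> card (- U)" if "matroid_rank ?D F = ?c - h" for F
    using min_nullity_size_le[of h \<Delta> "- F"] null_compl[OF that] card_compl[of F] card_compl[of U] U(2)
    by simp
  ultimately have "max_flat_size ?D (?c - h) = card (- U)"
    unfolding max_flat_size_def by (intro Max_eqI) auto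
  with card_compl[of U] U(2) show ?thesis by simp
qed

section \<open>Weights with large sums off every basis\<close>

text \<open>Layer-cake summation: \<open>i\<close> lies in exactly \<open>w i\<close> of the level
  sets numbered \<open>1\<close> to \<open>T\<close>.\<close>

lemma sum_eq_sum_card_levels:
  fixes w :: "'n::finite \<Rightarrow> nat"
  assumes "\<And>i. w i \<le> T"
  shows "sum w A = (\<Sum>t=1..T. card ({i. t \<le> w i} \<inter> A))"
proof -
  have "w i = (\<Sum>t=1..T. if t \<le> w i then 1 else 0)" for i
  proof -
    have "{1..T} \<inter> {t. t \<le> w i} = {1..w i}" using assms[of i] by auto
    then show ?thesis by (simp add: sum.If_cases)
  qed
  then have "sum w A = (\<Sum>i\<in>A. \<Sum>t=1..T. if t \<le> w i then 1 else 0)" by simp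
  also have "\<dots> = (\<Sum>t=1..T. \<Sum>i\<in>A. if t \<le> w i then 1 else 0)" by (rule sum.swap)
  also have "\<dots> = (\<Sum>t=1..T. card ({i. t \<le> w i} \<inter> A))"
    by (simp add: sum.If_cases Int_commute)
  finally show ?thesis .
qed

text \<open>Parts \<open>k t\<close> are collected until their total reaches \<open>l\<close>. The
  part that overshoots is shortened, which is no dearer since \<open>s\<close> is monotone, and
  later parts are dropped. \<open>a h\<close> counts how often the size \<open>h\<close>
  occurs.\<close>

lemma truncate_parts:
  fixes s k :: "nat \<Rightarrow> nat"
  assumes mono: "\<And>i j. 1 \<le> i \<Longrightarrow> i \<le> j \<Longrightarrow> j \<le> c \<Longrightarrow> s i \<le> s j"
    and k: "\<And>t. k t \<le> c" and l: "l \<le> (\<Sum>t=1..T. k t)"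
  shows "\<exists>a :: nat \<Rightarrow> nat. (\<Sum>h=1..c. h * a h) = l \<and> (\<Sum>h=1..c. a h * s h) \<le> (\<Sum>t=1..T. s (k t))"
  using l
proof (induction T arbitrary: l)
  case 0
  then show ?case by (intro exI[of _ "\<lambda>_. 0"]) simp
next
  case (Suc T)
  let ?K = "\<Sum>t=1..T. k t"
  show ?case
  proof (cases "l \<le> ?K")
    case True
    from Suc.IH[OF this] show ?thesis by (auto intro: le_trans)
  next
    case False
    \<comment> \<open>The portion of the last part \<open>k (Suc T)\<close> still missing to hit
      \<open>l\<close> exactly.\<close>
    define j where "j = l - ?K"
    have j: "1 \<le> j" "j \<le> k (Suc T)" "l = ?K + j" using False Suc.prems by (auto simp: j_def)
    then have jc: "j \<in> {1..c}" using k[of "Suc T"] by simp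
    obtain a where a: "(\<Sum>h=1..c. h * a h) = ?K" "(\<Sum>h=1..c. a h * s h) \<le> (\<Sum>t=1..T. s (k t))"
      using Suc.IH[of ?K] by auto
    define b where "b h = a h + (if h = j then 1 else 0)" for h
    have "(\<Sum>h=1..c. h * b h) = (\<Sum>h=1..c. h * a h + (if h = j then j else 0))"
      by (intro sum.cong) (auto simp: b_def)
    also have "\<dots> = l" using a(1) j(3) jc by (simp add: sum.distrib)
    finally have 1: "(\<Sum>h=1..c. h * b h) = l" .
    have "(\<Sum>h=1..c. b h * s h) = (\<Sum>h=1..c. a h * s h + (if h = j then s j else 0))"
      by (intro sum.cong) (auto simp: b_def)
    also have "\<dots> = (\<Sum>h=1..c. a h * s h) + s j" using jc by (simp add: sum.distrib)
    also have "\<dots> \<le> (\<Sum>t=1..Suc T. s (k t))" using a(2) mono[OF j(1,2) k] by simp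
    finally show ?thesis using 1 by blast
  qed
qed

text \<open>At a basis meeting all level sets in full rank, the hypothesis on \<open>w\<close> says
  that the nullities of the level sets add up to at least \<open>l\<close>, while their sizes add up
  to the total weight.\<close>

lemma weight_lower_bound:
  fixes \<Delta> :: "'n::finite set set" and w :: "'n \<Rightarrow> nat"
  assumes M: "matroid \<Delta>" and w: "\<And>B. B \<in> bases \<Delta> \<Longrightarrow> l \<le> sum w (- B)"
  shows "\<exists>a :: nat \<Rightarrow> nat. (\<Sum>h=1..nullity \<Delta> UNIV. h * a h) = l \<and>
    (\<Sum>h=1..nullity \<Delta> UNIV. a h * min_nullity_size \<Delta> h) \<le> sum w UNIV"
proof -
  \<comment> \<open>Any upper bound of the weights would do; the levels above it are empty.\<close>
  define T where "T = sum w UNIV"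
  have T: "w i \<le> T" for i unfolding T_def by (rule member_le_sum) auto
  define U where "U t = {i. t \<le> w i}" for t
  have dec: "U t \<subseteq> U s" if "s \<le> t" for s t using that by (auto simp: U_def)
  have U0: "U 0 = UNIV" by (simp add: U_def)
  obtain B where
    B: "B \<in> bases \<Delta>" "\<And>t. t \<le> T \<Longrightarrow> card (U t \<inter> B) = matroid_rank \<Delta> (U t)"
    using basis_chain[of \<Delta> U T] M dec U0 by blast
  have "sum w (- B) = (\<Sum>t=1..T. card (U t \<inter> - B))"
    unfolding U_def by (rule sum_eq_sum_card_levels[OF T])
  also have "\<dots> = (\<Sum>t=1..T. nullity \<Delta> (U t))"
    using B(2) by (intro sum.cong) (auto simp: nullity_def card_Diff_basis Diff_eq[symmetric])
  finally have l: "l \<le> (\<Sum>t=1..T. nullity \<Delta> (U t))" using w[OF B(1)] by simp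
  obtain a where a: "(\<Sum>h=1..nullity \<Delta> UNIV. h * a h) = l"
    "(\<Sum>h=1..nullity \<Delta> UNIV. a h * min_nullity_size \<Delta> h)
      \<le> (\<Sum>t=1..T. min_nullity_size \<Delta> (nullity \<Delta> (U t)))"
    using truncate_parts[of "nullity \<Delta> UNIV" "min_nullity_size \<Delta>" "\<lambda>t. nullity \<Delta> (U t)", OF _ _ l]
      min_nullity_size_mono[OF M] nullity_mono[OF M subset_UNIV] by blast
  note a(2)
  also have "(\<Sum>t=1..T. min_nullity_size \<Delta> (nullity \<Delta> (U t))) \<le> (\<Sum>t=1..T. card (U t \<inter> UNIV))"
    by (intro sum_mono) (simp add: min_nullity_size_le)
  also have "\<dots> = sum w UNIV"
    unfolding U_def by (rule sum_eq_sum_card_levels[OF T, symmetric])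
  finally show ?thesis using a(1) by blast
qed

text \<open>Superpose \<open>a h\<close> copies of the indicator of a smallest set
  \<open>U h\<close> of nullity \<open>h\<close>; every basis misses at least \<open>h\<close>
  elements of \<open>U h\<close>.\<close>

lemma weight_upper_bound:
  fixes \<Delta> :: "'n::finite set set" and a :: "nat \<Rightarrow> nat"
  assumes M: "matroid \<Delta>"
  obtains w :: "'n \<Rightarrow> nat" where
    "\<And>B. B \<in> bases \<Delta> \<Longrightarrow> (\<Sum>h=1..nullity \<Delta> UNIV. h * a h) \<le> sum w (- B)"
    "sum w UNIV = (\<Sum>h=1..nullity \<Delta> UNIV. a h * min_nullity_size \<Delta> h)"
proof -
  let ?c = "nullity \<Delta> UNIV"
  have "\<exists>U. h \<le> ?c \<longrightarrow> nullity \<Delta> U = h \<and> card U = min_nullity_size \<Delta> h" for h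
    using min_nullity_size_witness[OF M, of h] by blast
  then obtain U where U: "\<And>h. h \<le> ?c \<Longrightarrow> nullity \<Delta> (U h) = h \<and> card (U h) = min_nullity_size \<Delta> h"
    by metis
  define w where "w i = (\<Sum>h=1..?c. if i \<in> U h then a h else 0)" for i
  have sum_w: "sum w A = (\<Sum>h=1..?c. a h * card (U h \<inter> A))" for A
  proof -
    have "sum w A = (\<Sum>h=1..?c. \<Sum>i\<in>A. if i \<in> U h then a h else 0)"
      unfolding w_def by (rule sum.swap)
    also have "\<dots> = (\<Sum>h=1..?c. a h * card (U h \<inter> A))"
      by (simp add: sum.If_cases Int_commute mult.commute)
    finally show ?thesis .
  qed
  have "(\<Sum>h=1..?c. h * a h) \<le> sum w (- B)" if B: "B \<in> bases \<Delta>" for B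
    unfolding sum_w
  proof (rule sum_mono)
    fix h assume h: "h \<in> {1..?c}"
    then have "h \<le> card (U h \<inter> - B)"
      using nullity_le_card_Diff_basis[OF M B, of "U h"] U[of h] by (simp add: Diff_eq)
    then show "h * a h \<le> a h * card (U h \<inter> - B)" by simp
  qed
  moreover have "sum w UNIV = (\<Sum>h=1..?c. a h * min_nullity_size \<Delta> h)"
    unfolding sum_w using U by (intro sum.cong) auto
  ultimately show ?thesis using that by blast
qed

section \<open>Ideals of polynomials cut out by their exponents\<close>

text \<open>Sums introduce no new exponents and products only translates of old ones, so a condition
  stable under translation cuts out an ideal.\<close>

lemma subspace_keys: "ideal.subspace {f :: ('n, 'k::field) mpoly. \<forall>m\<in>Poly_Mapping.keys f. P m}"
  if up: "\<And>m m'. P m \<Longrightarrow> P (m' + m)"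
proof (rule ideal.subspaceI)
  fix f g :: "('n, 'k) mpoly"
  assume "f \<in> {f. \<forall>m\<in>Poly_Mapping.keys f. P m}" "g \<in> {f. \<forall>m\<in>Poly_Mapping.keys f. P m}"
  then show "f + g \<in> {f. \<forall>m\<in>Poly_Mapping.keys f. P m}"
    using Poly_Mapping.keys_add[of f g] by blast
next
  fix f g :: "('n, 'k) mpoly"
  assume "f \<in> {f. \<forall>m\<in>Poly_Mapping.keys f. P m}"
  then show "g * f \<in> {f. \<forall>m\<in>Poly_Mapping.keys f. P m}"
    using Poly_Mapping.keys_mult[of g f] up by blast
qed simp

lemma sum_single_lookup: "(\<Sum>m\<in>Poly_Mapping.keys f. Poly_Mapping.single m (Poly_Mapping.lookup f m)) = f"
proof (rule poly_mapping_eqI)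
  fix k
  have "Poly_Mapping.lookup (\<Sum>m\<in>Poly_Mapping.keys f. Poly_Mapping.single m (Poly_Mapping.lookup f m)) k
      = (\<Sum>m\<in>Poly_Mapping.keys f. if m = k then Poly_Mapping.lookup f k else 0)"
    unfolding lookup_sum by (intro sum.cong) (auto simp: lookup_single when_def)
  also have "\<dots> = Poly_Mapping.lookup f k" by (simp add: in_keys_iff)
  finally show "Poly_Mapping.lookup (\<Sum>m\<in>Poly_Mapping.keys f. Poly_Mapping.single m (Poly_Mapping.lookup f m)) k
      = Poly_Mapping.lookup f k" .
qed

lemma scaled_monomial: "Poly_Mapping.single m c = Poly_Mapping.single 0 c * monomial m"
  by (simp add: monomial_def mult_single)

lemma monomial_add: "monomial (m + m') = monomial m * monomial m'"
  by (simp add: monomial_def mult_single)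

lemma keys_monomial [simp]: "Poly_Mapping.keys (monomial m :: ('n, 'k::field) mpoly) = {m}"
  by (simp add: monomial_def)

lemma monomial_neq_0 [simp]: "(monomial m :: ('n, 'k::field) mpoly) \<noteq> 0"
  by (metis keys_monomial Poly_Mapping.keys_zero insert_not_empty)

lemma in_subspace_if_monomials:
  fixes f :: "('n, 'k::field) mpoly"
  assumes J: "ideal.subspace J" and "\<And>m. m \<in> Poly_Mapping.keys f \<Longrightarrow> monomial m \<in> J"
  shows "f \<in> J"
proof -
  have "(\<Sum>m\<in>Poly_Mapping.keys f. Poly_Mapping.single m (Poly_Mapping.lookup f m)) \<in> J"
    using assms by (intro ideal.subspace_sum[OF J]) (subst scaled_monomial, rule ideal.subspace_scale)
  then show ?thesis by (simp add: sum_single_lookup)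
qed

abbreviation degree_on :: "'n::finite set \<Rightarrow> ('n \<Rightarrow>\<^sub>0 nat) \<Rightarrow> nat" where
  "degree_on F m \<equiv> sum (Poly_Mapping.lookup m) F"

lemma degree_on_add: "degree_on F (m + m') = degree_on F m + degree_on F m'"
  by (simp add: lookup_add sum.distrib)

lemma degree_on_single: "degree_on F (Poly_Mapping.single i c) = (if i \<in> F then c else 0)"
proof -
  have "degree_on F (Poly_Mapping.single i c) = (\<Sum>j\<in>F. if i = j then c else 0)"
    by (intro sum.cong) (auto simp: lookup_single when_def)
  then show ?thesis by simp
qed

lemma degree_on_pos_split:
  assumes "Suc l \<le> degree_on F m"
  obtains i m' where "i \<in> F" "m = m' + Poly_Mapping.single i 1" "l \<le> degree_on F m'"
proof -
  obtain i where i: "i \<in> F" "Poly_Mapping.lookup m i \<noteq> 0"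
    using assms by (metis Suc_n_not_le_n le0 le_trans not_less_eq_eq sum.neutral)
  define m' where "m' = m - Poly_Mapping.single i 1"
  have "m = m' + Poly_Mapping.single i 1"
    using i(2) by (intro poly_mapping_eqI)
      (auto simp: m'_def lookup_add lookup_minus lookup_single when_def)
  with assms i(1) that show ?thesis
    by (metis Suc_eq_plus1 Suc_le_mono degree_on_add degree_on_single)
qed

text \<open>This is the \<open>l\<close>-th power of the ideal generated by the variables in
  \<open>F\<close>, in a form where membership is tested exponent by exponent.\<close>

definition degree_on_ideal :: "'n::finite set \<Rightarrow> nat \<Rightarrow> ('n, 'k::field) mpoly set" where
  "degree_on_ideal F l = {f. \<forall>m\<in>Poly_Mapping.keys f. l \<le> degree_on F m}"

lemma subspace_degree_on_ideal: "ideal.subspace (degree_on_ideal F l)"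
  unfolding degree_on_ideal_def by (rule subspace_keys) (simp add: degree_on_add)

lemma var_ideal_eq: "var_ideal F = (degree_on_ideal F 1 :: ('n::finite, 'k::field) mpoly set)"
proof (rule equalityI)
  show "var_ideal F \<subseteq> (degree_on_ideal F 1 :: ('n, 'k) mpoly set)"
    unfolding var_ideal_def
    by (intro ideal.span_minimal subspace_degree_on_ideal)
      (auto simp: degree_on_ideal_def var_def degree_on_single)
  have mono: "monomial m \<in> (var_ideal F :: ('n, 'k) mpoly set)" if m: "1 \<le> degree_on F m" for m
  proof -
    obtain i m' where "i \<in> F" "m = m' + Poly_Mapping.single i 1"
      using degree_on_pos_split[of 0 m F] m by auto
    then show ?thesis
      unfolding var_ideal_def by (simp only: monomial_add)
        (intro ideal.span_scale ideal.span_base, simp add: var_def)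
  qed
  show "(degree_on_ideal F 1 :: ('n, 'k) mpoly set) \<subseteq> var_ideal F"
    by (rule subsetI, rule in_subspace_if_monomials[OF ideal.subspace_span, of _ "var ` F", folded var_ideal_def])
      (simp add: degree_on_ideal_def mono)
qed

text \<open>A monomial of weight at least \<open>Suc l\<close> on \<open>F\<close> has a variable of
  \<open>F\<close> to split off, leaving weight at least \<open>l\<close>; conversely, weights add
  under multiplication.\<close>

lemma ideal_power_var_ideal:
  "ideal_power (var_ideal F) l = (degree_on_ideal F l :: ('n::finite, 'k::field) mpoly set)"
proof (induction l)
  case 0
  show ?case by (simp add: degree_on_ideal_def)
next
  case (Suc l)
  let ?S = "{a * b | a b. a \<in> var_ideal F \<and> b \<in> (degree_on_ideal F l :: ('n, 'k) mpoly set)}"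
  have "?S \<subseteq> degree_on_ideal F (Suc l)"
  proof clarify
    fix a b :: "('n, 'k) mpoly" assume ab: "a \<in> var_ideal F" "b \<in> degree_on_ideal F l"
    have "Suc l \<le> degree_on F m" if m: "m \<in> Poly_Mapping.keys (a * b)" for m
    proof -
      obtain p q where "p \<in> Poly_Mapping.keys a" "q \<in> Poly_Mapping.keys b" "m = p + q"
        using m Poly_Mapping.keys_mult[of a b] by blast
      then show ?thesis
        using ab by (fastforce simp: var_ideal_eq degree_on_ideal_def degree_on_add)
    qed
    then show "a * b \<in> degree_on_ideal F (Suc l)" by (simp add: degree_on_ideal_def)
  qed
  then have sub: "ideal.span ?S \<subseteq> degree_on_ideal F (Suc l)"
    by (intro ideal.span_minimal subspace_degree_on_ideal)
  have mono: "monomial m \<in> ideal.span ?S" if m: "Suc l \<le> degree_on F m" for m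
  proof -
    obtain i m' where i: "i \<in> F" "m = m' + Poly_Mapping.single i 1" "l \<le> degree_on F m'"
      using degree_on_pos_split[OF m] .
    then have "(monomial m :: ('n, 'k) mpoly) = monomial (Poly_Mapping.single i 1) * monomial m'"
      by (simp add: monomial_add mult.commute)
    moreover have "monomial (Poly_Mapping.single i 1) \<in> (var_ideal F :: ('n, 'k) mpoly set)"
      "monomial m' \<in> (degree_on_ideal F l :: ('n, 'k) mpoly set)"
      using i by (auto simp: var_ideal_eq degree_on_ideal_def degree_on_single)
    ultimately show ?thesis by (intro ideal.span_base) blast
  qed
  have "degree_on_ideal F (Suc l) \<subseteq> ideal.span ?S"
    by (rule subsetI, rule in_subspace_if_monomials[OF ideal.subspace_span])
      (use mono in \<open>simp add: degree_on_ideal_def\<close>)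
  with sub show ?case by (simp add: Suc)
qed

section \<open>Primality of the variable ideals\<close>

lemma lookup_mult_sum:
  fixes f g :: "'a::monoid_add \<Rightarrow>\<^sub>0 'b::semiring_0"
  shows "Poly_Mapping.lookup (f * g) k = (\<Sum>p\<in>Poly_Mapping.keys f \<times> Poly_Mapping.keys g.
    if fst p + snd p = k then Poly_Mapping.lookup f (fst p) * Poly_Mapping.lookup g (snd p) else 0)"
proof -
  have "f * g = (\<Sum>a\<in>Poly_Mapping.keys f. \<Sum>b\<in>Poly_Mapping.keys g.
      Poly_Mapping.single a (Poly_Mapping.lookup f a) * Poly_Mapping.single b (Poly_Mapping.lookup g b))"
    by (subst (1) sum_single_lookup[of f, symmetric], subst (1) sum_single_lookup[of g, symmetric])
      (simp only: sum_product)
  also have "\<dots> = (\<Sum>p\<in>Poly_Mapping.keys f \<times> Poly_Mapping.keys g. Poly_Mapping.single (fst p + snd p)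
      (Poly_Mapping.lookup f (fst p) * Poly_Mapping.lookup g (snd p)))"
    by (simp add: mult_single sum.cartesian_product split_def)
  finally show ?thesis
    by (simp add: lookup_sum lookup_single when_def)
qed

text \<open>
  The index type carries no order; the lexicographic order on \<open>nat \<Rightarrow>\<^sub>0 nat\<close> pulls back to a monomial
  order, so that products of leading terms cannot cancel.
\<close>

lemma additive_embedding:
  "\<exists>w :: ('n::finite \<Rightarrow>\<^sub>0 nat) \<Rightarrow> (nat \<Rightarrow>\<^sub>0 nat). inj w \<and> (\<forall>a b. w (a + b) = w a + w b)"
proof -
  obtain e :: "'n \<Rightarrow> nat" where e: "inj e"
    using finite_imp_inj_to_nat_seg[of "UNIV :: 'n set"] by auto
  define w where "w m = (\<Sum>i\<in>UNIV. Poly_Mapping.single (e i) (Poly_Mapping.lookup m i))"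
    for m :: "'n \<Rightarrow>\<^sub>0 nat"
  have "Poly_Mapping.lookup (w m) (e i) = Poly_Mapping.lookup m i" for m i
  proof -
    have "Poly_Mapping.lookup (w m) (e i) = (\<Sum>j\<in>UNIV. if j = i then Poly_Mapping.lookup m i else 0)"
      unfolding w_def lookup_sum using e
      by (intro sum.cong) (auto simp: lookup_single when_def dest: injD)
    then show ?thesis by simp
  qed
  then have "inj w" by (metis injI poly_mapping_eqI)
  moreover have "w (a + b) = w a + w b" for a b
    by (simp add: w_def lookup_add single_add sum.distrib)
  ultimately show ?thesis by blast
qed

text \<open>Only exponents vanishing on \<open>F\<close> matter modulo \<open>var_ideal F\<close>.
  If \<open>a\<close> and \<open>b\<close> are the \<open>w\<close>-largest such exponents of
  \<open>f\<close> and \<open>g\<close>, then \<open>a + b\<close> comes from this pair alone, so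
  its coefficient is a product of nonzero field elements.\<close>

lemma prime_ideal_var_ideal: "prime_ideal (var_ideal F :: ('n::finite, 'k::field) mpoly set)"
proof -
  obtain w :: "('n \<Rightarrow>\<^sub>0 nat) \<Rightarrow> (nat \<Rightarrow>\<^sub>0 nat)"
    where w: "inj w" "\<And>a b. w (a + b) = w a + w b"
    using additive_embedding by blast
  have leading: "\<exists>a\<in>Poly_Mapping.keys f. degree_on F a = 0 \<and>
      (\<forall>b\<in>Poly_Mapping.keys f. degree_on F b = 0 \<longrightarrow> w b \<le> w a)"
    if "f \<notin> var_ideal F" for f :: "('n, 'k) mpoly"
  proof -
    let ?A = "{a \<in> Poly_Mapping.keys f. degree_on F a = 0}"
    have "?A \<noteq> {}"
      using that by (auto simp: var_ideal_eq degree_on_ideal_def Suc_le_eq simp del: sum_eq_0_iff)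
    then have "Max (w ` ?A) \<in> w ` ?A" by (intro Max_in) auto
    then obtain a where a: "a \<in> ?A" "w a = Max (w ` ?A)" by auto
    have "w b \<le> w a" if "b \<in> ?A" for b unfolding a(2) using that by (intro Max_ge) auto
    with a(1) show ?thesis by blast
  qed
  have "f * g \<notin> var_ideal F" if fg: "f \<notin> var_ideal F" "g \<notin> var_ideal F" for f g :: "('n, 'k) mpoly"
  proof -
    obtain a where a: "a \<in> Poly_Mapping.keys f" "degree_on F a = 0"
      "\<And>b. b \<in> Poly_Mapping.keys f \<Longrightarrow> degree_on F b = 0 \<Longrightarrow> w b \<le> w a"
      using leading[OF fg(1)] by blast
    obtain b where b: "b \<in> Poly_Mapping.keys g" "degree_on F b = 0"
      "\<And>c. c \<in> Poly_Mapping.keys g \<Longrightarrow> degree_on F c = 0 \<Longrightarrow> w c \<le> w b"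
      using leading[OF fg(2)] by blast
    \<comment> \<open>Weights add, so \<open>p\<close> and \<open>q\<close> also vanish on
      \<open>F\<close> and are bounded by \<open>a\<close> and \<open>b\<close>; a strict drop in
      either would make the sum too small.\<close>
    have unique: "p = a \<and> q = b"
      if "p \<in> Poly_Mapping.keys f" "q \<in> Poly_Mapping.keys g" "p + q = a + b" for p q
    proof -
      have "degree_on F p + degree_on F q = 0"
        using that(3) a(2) b(2) by (metis degree_on_add add_0)
      then have "w p \<le> w a" "w q \<le> w b" using a(3) b(3) that by simp_all
      moreover have "w p + w q = w a + w b" using that(3) w(2) by metis
      ultimately have "w p = w a" "w q = w b"
        by (metis add_less_le_mono add_le_less_mono order.not_eq_order_implies_strict order_less_irrefl)+
      then show ?thesis using w(1) by (simp add: inj_eq)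
    qed
    have "Poly_Mapping.lookup (f * g) (a + b) =
        (\<Sum>p\<in>Poly_Mapping.keys f \<times> Poly_Mapping.keys g.
          if p = (a, b) then Poly_Mapping.lookup f a * Poly_Mapping.lookup g b else 0)"
      unfolding lookup_mult_sum using unique by (intro sum.cong) auto
    also have "\<dots> \<noteq> 0" using a(1) b(1) by (simp add: in_keys_iff)
    finally have "a + b \<in> Poly_Mapping.keys (f * g)" by (simp add: in_keys_iff)
    moreover have "degree_on F (a + b) = 0" using a(2) b(2) by (simp only: degree_on_add)
    ultimately show ?thesis by (force simp: var_ideal_eq degree_on_ideal_def)
  qed
  moreover have "(1 :: ('n, 'k) mpoly) \<notin> var_ideal F"
    by (simp add: var_ideal_eq degree_on_ideal_def)
  moreover have "ideal.subspace (var_ideal F :: ('n, 'k) mpoly set)"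
    by (simp add: var_ideal_def)
  ultimately show ?thesis unfolding prime_ideal_def by blast
qed

lemma var_ideal_subset_iff:
  "(var_ideal F :: ('n::finite, 'k::field) mpoly set) \<subseteq> var_ideal G \<longleftrightarrow> F \<subseteq> G"
proof
  assume sub: "(var_ideal F :: ('n, 'k) mpoly set) \<subseteq> var_ideal G"
  have "var i \<in> (var_ideal H :: ('n, 'k) mpoly set) \<longleftrightarrow> i \<in> H" for i H
    by (simp add: var_ideal_eq degree_on_ideal_def var_def degree_on_single)
  with sub show "F \<subseteq> G" by blast
next
  assume "F \<subseteq> G"
  then show "(var_ideal F :: ('n, 'k) mpoly set) \<subseteq> var_ideal G"
    unfolding var_ideal_def by (intro ideal.span_mono image_mono)
qed

section \<open>Associated primes\<close>

text \<open>Otherwise pick an element of each \<open>J F\<close> outside \<open>P\<close>: the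
  product lies in the intersection but, by primality, not in \<open>P\<close>. For empty
  \<open>S\<close> the product is \<open>1\<close>, excluded because \<open>P\<close> is
  proper.\<close>

lemma prime_ideal_contains_factor:
  assumes P: "prime_ideal P" and fin: "finite S"
    and J: "\<And>F. F \<in> S \<Longrightarrow> ideal.subspace (J F)" and sub: "(\<Inter>F\<in>S. J F) \<subseteq> P"
  shows "\<exists>F\<in>S. J F \<subseteq> P"
proof (rule ccontr)
  assume "\<not> (\<exists>F\<in>S. J F \<subseteq> P)"
  then have "\<exists>g. F \<in> S \<longrightarrow> g \<in> J F \<and> g \<notin> P" for F by blast
  then obtain g where g: "\<And>F. F \<in> S \<Longrightarrow> g F \<in> J F \<and> g F \<notin> P" by metis
  have 1: "1 \<notin> P"
    using P ideal.subspace_scale[of P 1] by (auto simp: prime_ideal_def)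
  have "prod g S' \<notin> P" if "S' \<subseteq> S" for S'
    using finite_subset[OF that fin] that
    by (induction S') (use 1 g P in \<open>auto simp: prime_ideal_def\<close>)
  moreover have "prod g S \<in> J F" if "F \<in> S" for F
    using ideal.subspace_scale[OF J[OF that], of "g F" "prod g (S - {F})"] g[OF that]
      prod.remove[OF fin that, of g] by (simp add: mult.commute)
  ultimately show False using sub by blast
qed

text \<open>The annihilator of the class of \<open>f\<close> is the intersection of those
  \<open>J F\<close> that do not contain \<open>f\<close>. If it is prime, it equals one of
  them.\<close>

lemma Ass_quotient_Inter_primes:
  assumes fin: "finite S" and prime: "\<And>F. F \<in> S \<Longrightarrow> prime_ideal (J F)"
    and anti: "\<And>F G. F \<in> S \<Longrightarrow> G \<in> S \<Longrightarrow> J F \<subseteq> J G \<Longrightarrow> F = G"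
  shows "Ass_quotient (\<Inter>F\<in>S. J F) = J ` S"
proof -
  have sub: "ideal.subspace (J F)" if "F \<in> S" for F using prime[OF that] by (simp add: prime_ideal_def)
  have mem: "g * f \<in> J F \<longleftrightarrow> g \<in> J F \<or> f \<in> J F" if "F \<in> S" for g f F
    using prime[OF that] ideal.subspace_scale[OF sub[OF that]]
    unfolding prime_ideal_def by (metis mult.commute)
  have ann: "{g. g * f \<in> (\<Inter>F\<in>S. J F)} = (\<Inter>F\<in>{F\<in>S. f \<notin> J F}. J F)" for f
    using mem by blast
  show ?thesis
  proof (intro equalityI subsetI)
    fix P assume "P \<in> Ass_quotient (\<Inter>F\<in>S. J F)"
    then obtain f where P: "prime_ideal P" "P = (\<Inter>F\<in>{F\<in>S. f \<notin> J F}. J F)"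
      unfolding Ass_quotient_def ann by blast
    then obtain F where "F \<in> S" "f \<notin> J F" "J F \<subseteq> P"
      using prime_ideal_contains_factor[of P "{F\<in>S. f \<notin> J F}" J] fin sub by auto
    with P(2) have "P = J F" by blast
    with \<open>F \<in> S\<close> show "P \<in> J ` S" by blast
  next
    fix P assume "P \<in> J ` S"
    then obtain F where F: "F \<in> S" "P = J F" by blast
    \<comment> \<open>The antichain condition yields an \<open>f\<close> lying in all components
      except \<open>J F\<close>, and the annihilator of its class is then \<open>J F\<close>
      itself.\<close>
    have "\<not> (\<Inter>G\<in>S - {F}. J G) \<subseteq> J F"
      using prime_ideal_contains_factor[of "J F" "S - {F}" J] prime[OF F(1)] fin sub anti F(1) by blast
    then obtain f where f: "f \<notin> J F" "\<And>G. G \<in> S \<Longrightarrow> G \<noteq> F \<Longrightarrow> f \<in> J G" by blast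
    then have "{G\<in>S. f \<notin> J G} = {F}" using F(1) by blast
    then have "{g. g * f \<in> (\<Inter>F\<in>S. J F)} = J F" unfolding ann by simp
    then show "P \<in> Ass_quotient (\<Inter>F\<in>S. J F)"
      using prime[OF F(1)] F(2) unfolding Ass_quotient_def by blast
  qed
qed

section \<open>Heights of the variable ideals\<close>

text \<open>Linear independence over \<open>'k\<close> of the residue classes modulo
  \<open>P\<close> of an indexed family; \<open>Poly_Mapping.single 0\<close> embeds the scalars as
  constant polynomials.\<close>

definition indep_mod :: "('n, 'k::field) mpoly set \<Rightarrow> 'j set \<Rightarrow> ('j \<Rightarrow> ('n, 'k) mpoly) \<Rightarrow> bool" where
  "indep_mod P J v \<longleftrightarrow>
     (\<forall>u. (\<Sum>j\<in>J. Poly_Mapping.single 0 (u j) * v j) \<in> P \<longrightarrow> (\<forall>j\<in>J. u j = 0))"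

text \<open>Bounding each variable separately, instead of the total degree, makes the relevant
  counts plain powers of \<open>E + 1\<close>.\<close>

definition exponent_box :: "nat \<Rightarrow> ('n \<Rightarrow>\<^sub>0 nat) set" where
  "exponent_box E = {m. \<forall>i. Poly_Mapping.lookup m i \<le> E}"

lemma keys_mult_exponent_box:
  assumes "Poly_Mapping.keys f \<subseteq> exponent_box E" "Poly_Mapping.keys g \<subseteq> exponent_box E'"
  shows "Poly_Mapping.keys (f * g) \<subseteq> exponent_box (E + E')"
proof
  fix m assume "m \<in> Poly_Mapping.keys (f * g)"
  then obtain a b where "a \<in> Poly_Mapping.keys f" "b \<in> Poly_Mapping.keys g" "m = a + b"
    using Poly_Mapping.keys_mult[of f g] by blast
  then show "m \<in> exponent_box (E + E')"
    using assms by (auto simp: exponent_box_def lookup_add intro!: add_mono)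
qed

lemma exponent_box_mono: "E \<le> E' \<Longrightarrow> exponent_box E \<subseteq> exponent_box E'"
  by (auto simp: exponent_box_def intro: le_trans)

lemma keys_power_exponent_box:
  fixes f :: "('n, 'k::field) mpoly"
  assumes "Poly_Mapping.keys f \<subseteq> exponent_box E"
  shows "Poly_Mapping.keys (f ^ b) \<subseteq> exponent_box (b * E)"
proof (induction b)
  case 0
  then show ?case by (simp add: exponent_box_def)
next
  case (Suc b)
  from keys_mult_exponent_box[OF assms Suc] show ?case by simp
qed

lemma keys_subset_exponent_box:
  fixes f :: "('n::finite, 'k::field) mpoly"
  shows "\<exists>E. Poly_Mapping.keys f \<subseteq> exponent_box E"
proof
  let ?E = "\<Sum>m\<in>Poly_Mapping.keys f. \<Sum>i\<in>UNIV. Poly_Mapping.lookup m i"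
  have "Poly_Mapping.lookup m i \<le> ?E" if "m \<in> Poly_Mapping.keys f" for m i
  proof -
    have "Poly_Mapping.lookup m i \<le> (\<Sum>i\<in>UNIV. Poly_Mapping.lookup m i)"
      by (rule member_le_sum) auto
    also have "\<dots> \<le> ?E" using that by (intro member_le_sum) auto
    finally show ?thesis .
  qed
  then show "Poly_Mapping.keys f \<subseteq> exponent_box ?E" by (auto simp: exponent_box_def)
qed

lemma card_exponent_box:
  "finite (exponent_box E :: ('n::finite \<Rightarrow>\<^sub>0 nat) set)"
  "card (exponent_box E :: ('n \<Rightarrow>\<^sub>0 nat) set) \<le> (E + 1) ^ CARD('n)"
proof -
  have inj: "inj_on Poly_Mapping.lookup (exponent_box E :: ('n \<Rightarrow>\<^sub>0 nat) set)"
    by (rule inj_onI) (simp only: poly_mapping_eq_iff)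
  have sub: "Poly_Mapping.lookup ` exponent_box E \<subseteq> (UNIV :: 'n set) \<rightarrow>\<^sub>E {..E}"
    by (auto simp: exponent_box_def)
  have fin: "finite ((UNIV :: 'n set) \<rightarrow>\<^sub>E {..E})" by (intro finite_PiE) auto
  show "finite (exponent_box E :: ('n \<Rightarrow>\<^sub>0 nat) set)"
    by (rule inj_on_finite[OF inj sub fin])
  show "card (exponent_box E :: ('n \<Rightarrow>\<^sub>0 nat) set) \<le> (E + 1) ^ CARD('n)"
    using card_inj_on_le[OF inj sub fin] by (simp add: card_PiE)
qed

text \<open>As \<open>0 \<in> P\<close>, independence modulo \<open>P\<close> implies ordinary
  independence, inside the span of the monomials of the box.\<close>

lemma indep_mod_card_le:
  fixes v :: "'j \<Rightarrow> ('n::finite, 'k::field) mpoly"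
  assumes fin: "finite J" and ind: "indep_mod P J v" and "0 \<in> P"
    and box: "\<And>j. j \<in> J \<Longrightarrow> Poly_Mapping.keys (v j) \<subseteq> exponent_box E"
  shows "card J \<le> (E + 1) ^ CARD('n)"
proof -
  interpret vs: vector_space "\<lambda>c (f :: ('n, 'k) mpoly). Poly_Mapping.single 0 c * f"
    by unfold_locales (simp_all add: distrib_left distrib_right single_add mult_single flip: mult.assoc)
  have ind: "u j = 0" if "(\<Sum>j\<in>J. Poly_Mapping.single 0 (u j) * v j) = 0" "j \<in> J" for u j
    using ind that \<open>0 \<in> P\<close> unfolding indep_mod_def by metis
  \<comment> \<open>A repeated vector would give the nontrivial relation
    \<open>v i - v j = 0\<close>; with injectivity the family can be replaced by its image.\<close>
  have inj: "inj_on v J"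
  proof (rule inj_onI, rule ccontr)
    fix i j assume ij: "i \<in> J" "j \<in> J" "v i = v j" "i \<noteq> j"
    let ?u = "\<lambda>x. if x = i then 1 else if x = j then - 1 else (0 :: 'k)"
    have "(\<Sum>x\<in>J. Poly_Mapping.single 0 (?u x) * v x)
        = (\<Sum>x\<in>J. (if x = i then v i else 0) + (if x = j then - v i else 0))"
      using ij by (intro sum.cong) (auto simp flip: single_one simp: single_uminus)
    also have "\<dots> = 0" using ij fin by (simp add: sum.distrib)
    finally have "?u i = 0" using ij(1) by (rule ind)
    then show False by simp
  qed
  have "vs.independent (v ` J)"
  proof (rule vs.independent_if_scalars_zero)
    fix u x assume "(\<Sum>x\<in>v ` J. Poly_Mapping.single 0 (u x) * x) = 0" "x \<in> v ` J"
    then show "u x = 0"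
      using ind[of "u \<circ> v"] by (auto simp: sum.reindex[OF inj])
  qed (use fin in simp)
  moreover have "v ` J \<subseteq> vs.span (monomial ` exponent_box E)"
  proof clarify
    fix j assume "j \<in> J"
    have "(\<Sum>m\<in>Poly_Mapping.keys (v j). Poly_Mapping.single m (Poly_Mapping.lookup (v j) m))
        \<in> vs.span (monomial ` exponent_box E)"
      using box[OF \<open>j \<in> J\<close>]
      by (intro vs.span_sum) (subst scaled_monomial, intro vs.span_scale vs.span_base, blast)
    then show "v j \<in> vs.span (monomial ` exponent_box E)" by (simp add: sum_single_lookup)
  qed
  ultimately have "card (v ` J) \<le> card ((monomial :: _ \<Rightarrow> ('n, 'k) mpoly) ` exponent_box E)"
    using vs.independent_span_bound[of "monomial ` exponent_box E" "v ` J"] card_exponent_box(1) by blast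
  also have "\<dots> \<le> card (exponent_box E :: ('n \<Rightarrow>\<^sub>0 nat) set)"
    by (rule card_image_le[OF card_exponent_box(1)])
  also have "\<dots> \<le> (E + 1) ^ CARD('n)" by (rule card_exponent_box(2))
  finally show ?thesis by (simp add: card_image[OF inj])
qed

text \<open>Moves families to index sets of naturals, so that an induction which forms products of
  index sets stays within one type.\<close>

lemma indep_mod_reindex:
  fixes v :: "'j \<Rightarrow> ('n, 'k::field) mpoly"
  assumes e: "bij_betw e I J" and "indep_mod P J v"
  shows "indep_mod P I (v \<circ> e)"
  unfolding indep_mod_def
proof (intro allI impI ballI)
  fix u i assume u: "(\<Sum>i\<in>I. Poly_Mapping.single 0 (u i) * (v \<circ> e) i) \<in> P" and i: "i \<in> I"
  define u' where "u' = u \<circ> inv_into I e"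
  have u': "u' (e i) = u i" if "i \<in> I" for i
    using that e by (simp add: u'_def bij_betw_def)
  have "(\<Sum>j\<in>J. Poly_Mapping.single 0 (u' j) * v j)
      = (\<Sum>i\<in>I. Poly_Mapping.single 0 (u' (e i)) * v (e i))"
    by (rule sum.reindex_bij_betw[OF e, symmetric])
  also have "\<dots> = (\<Sum>i\<in>I. Poly_Mapping.single 0 (u i) * (v \<circ> e) i)"
    by (intro sum.cong) (simp_all add: u')
  finally have "\<forall>j\<in>J. u' j = 0" using u assms(2) unfolding indep_mod_def by metis
  then show "u i = 0" using u'[OF i] bij_betwE[OF e] i by metis
qed

text \<open>Read a relation as a polynomial in \<open>f\<close>. Modulo \<open>Q\<close> only its
  constant term \<open>g 0\<close> survives, so the coefficients there vanish; the rest is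
  \<open>S * f \<in> P\<close>, and primality of \<open>P\<close> strips one factor
  \<open>f\<close>, which lowers \<open>D\<close>.\<close>

lemma indep_mod_powers:
  fixes v :: "'j \<Rightarrow> ('n, 'k::field) mpoly"
  assumes P: "prime_ideal P" and Q: "ideal.subspace Q" and sub: "P \<subseteq> Q" and f: "f \<in> Q" "f \<notin> P"
    and ind: "indep_mod Q J v"
  shows "indep_mod P (J \<times> {..D}) (\<lambda>(j, b). v j * f ^ b)"
proof -
  have vanish: "\<forall>b\<le>D. \<forall>j\<in>J. u j b = 0"
    if "(\<Sum>b\<le>D. (\<Sum>j\<in>J. Poly_Mapping.single 0 (u j b) * v j) * f ^ b) \<in> P" for u
    using that
  proof (induction D arbitrary: u)
    case 0
    then show ?case using ind sub by (auto simp: indep_mod_def)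
  next
    case (Suc D)
    define g where "g b = (\<Sum>j\<in>J. Poly_Mapping.single 0 (u j b) * v j)" for b
    define S where "S = (\<Sum>b\<le>D. g (Suc b) * f ^ b)"
    have split: "(\<Sum>b\<le>Suc D. g b * f ^ b) = g 0 + S * f"
      unfolding S_def sum.atMost_Suc_shift sum_distrib_right by (simp only: power_Suc2 power_0 mult.assoc mult_1_right)
    have "g 0 + S * f \<in> P" using Suc.prems by (simp only: flip: split g_def)
    then have "(g 0 + S * f) - S * f \<in> Q"
      using sub f(1) by (intro ideal.subspace_diff[OF Q] ideal.subspace_scale[OF Q]) auto
    then have "g 0 \<in> Q" by simp
    then have u0: "\<forall>j\<in>J. u j 0 = 0" 
      using ind[unfolded indep_mod_def, THEN spec, of "\<lambda>j. u j 0"] unfolding g_def by simp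
    then have "g 0 = 0" unfolding g_def by simp
    with \<open>g 0 + S * f \<in> P\<close> P f(2) have "S \<in> P" unfolding prime_ideal_def by auto
    then have "\<forall>b\<le>D. \<forall>j\<in>J. u j (Suc b) = 0"
      using Suc.IH[of "\<lambda>j b. u j (Suc b)"] unfolding S_def g_def by blast
    with u0 show ?case by (metis Suc_le_mono not0_implies_Suc)
  qed
  have regroup: "(\<Sum>x\<in>J \<times> {..D}. Poly_Mapping.single 0 (u x) * (case x of (j, b) \<Rightarrow> v j * f ^ b))
      = (\<Sum>b\<le>D. (\<Sum>j\<in>J. Poly_Mapping.single 0 (u (j, b)) * v j) * f ^ b)" for u
  proof -
    have "(\<Sum>x\<in>J \<times> {..D}. Poly_Mapping.single 0 (u x) * (case x of (j, b) \<Rightarrow> v j * f ^ b))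
      = (\<Sum>j\<in>J. \<Sum>b\<le>D. Poly_Mapping.single 0 (u (j, b)) * v j * f ^ b)"
      unfolding sum.cartesian_product by (rule sum.cong) (auto simp only: split_def mult.assoc fst_conv snd_conv)
    then show ?thesis by (subst (asm) sum.swap) (simp add: sum_distrib_right)
  qed
  show ?thesis
    unfolding indep_mod_def
  proof (intro allI impI ballI)
    fix u x
    assume "(\<Sum>x\<in>J \<times> {..D}. Poly_Mapping.single 0 (u x) * (case x of (j, b) \<Rightarrow> v j * f ^ b)) \<in> P"
      and x: "x \<in> J \<times> {..D}"
    then have "\<forall>b\<le>D. \<forall>j\<in>J. u (j, b) = 0" using vanish[of "\<lambda>j b. u (j, b)"] unfolding regroup by simp
    with x show "u x = 0" by auto
  qed
qed

text \<open>Modulo the variables in \<open>F\<close> a polynomial ring in the other variables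
  remains, where monomials are still independent; the count starts here at the top of a
  chain.\<close>

lemma indep_mod_monomials:
  "indep_mod (var_ideal F :: ('n::finite, 'k::field) mpoly set) {m \<in> exponent_box D. degree_on F m = 0} monomial"
  unfolding indep_mod_def
proof (intro allI impI ballI)
  fix u :: "('n \<Rightarrow>\<^sub>0 nat) \<Rightarrow> 'k" and m
  let ?J = "{m \<in> exponent_box D. degree_on F m = 0}"
  let ?f = "\<Sum>m\<in>?J. Poly_Mapping.single 0 (u m) * monomial m"
  assume f: "?f \<in> var_ideal F" and m: "m \<in> ?J"
  have "Poly_Mapping.lookup ?f m = (\<Sum>m'\<in>?J. if m' = m then u m else 0)"
    unfolding lookup_sum by (intro sum.cong) (auto simp: monomial_def mult_single lookup_single when_def)
  also have "\<dots> = u m" using m card_exponent_box(1)[where 'n='n, of D] by simp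
  finally have lookup: "Poly_Mapping.lookup ?f m = u m" .
  show "u m = 0"
  proof (rule ccontr)
    assume "u m \<noteq> 0"
    then have "m \<in> Poly_Mapping.keys ?f" unfolding in_keys_iff lookup .
    with f have "1 \<le> degree_on F m" unfolding var_ideal_eq degree_on_ideal_def by blast
    with m show False by simp
  qed
qed

lemma card_box_monomials_ge:
  "(D + 1) ^ card (- F) \<le> card {m \<in> exponent_box D. degree_on (F :: 'n::finite set) m = 0}"
proof -
  let ?ext = "\<lambda>g :: 'n \<Rightarrow> nat. Abs_poly_mapping (\<lambda>i. if i \<in> F then 0 else g i)"
  let ?G = "(- F) \<rightarrow>\<^sub>E {..D}"
  have lookup: "Poly_Mapping.lookup (?ext g) i = (if i \<in> F then 0 else g i)" for g i
    by (subst lookup_Abs_poly_mapping) auto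
  have "inj_on ?ext ?G"
  proof (rule inj_onI)
    fix g h assume gh: "g \<in> ?G" "h \<in> ?G" "?ext g = ?ext h"
    show "g = h"
    proof (rule PiE_ext[OF gh(1,2)])
      fix i assume "i \<in> - F"
      then show "g i = h i" using lookup[of g i] lookup[of h i] gh(3) by simp
    qed
  qed
  moreover have "?ext ` ?G \<subseteq> {m \<in> exponent_box D. degree_on F m = 0}"
    by (auto simp: exponent_box_def lookup dest: PiE_mem)
  ultimately have "card ?G \<le> card {m \<in> exponent_box D. degree_on F m = 0}"
    by (rule card_inj_on_le) (simp add: card_exponent_box(1))
  then show ?thesis by (simp add: card_PiE)
qed

text \<open>
  Independent families grow along a descending chain of primes: if \<open>v\<close> is independent modulo \<open>Q\<close>
  and \<open>f \<in> Q - P\<close>, then the \<open>v\<^sub>j f\<^sup>b\<close> are independent modulo \<open>P\<close>. A chain of length \<open>m\<close> ending in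
  \<open>var_ideal F\<close> thus gives \<open>(D + 1)\<close> to the power \<open>n - card F + m\<close> independent polynomials of
  degree \<open>O(D)\<close> in each variable, while the space of such polynomials has dimension \<open>O(D\<^sup>n)\<close>.
\<close>

lemma prime_chain_below_var_ideal:
  fixes Q :: "nat \<Rightarrow> ('n::finite, 'k::field) mpoly set"
  assumes prime: "\<And>i. i \<le> m \<Longrightarrow> prime_ideal (Q i)" and chain: "\<And>i. i < m \<Longrightarrow> Q i \<subset> Q (Suc i)"
    and top: "Q m = var_ideal F"
  shows "m \<le> card F"
proof -
  have sub: "ideal.subspace (Q i)" if "i \<le> m" for i using prime[OF that] by (simp add: prime_ideal_def)
  let ?N = "\<lambda>D k. (D + 1) ^ (card (- F) + k)"
  \<comment> \<open>\<open>K\<close> must not depend on \<open>D\<close>: it collects the degrees of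
    the finitely many elements \<open>f\<close> chosen along the chain, and \<open>D\<close> is
    fixed only at the end.\<close>
  have "\<exists>K. \<forall>D. \<exists>(J :: nat set) v. finite J \<and> ?N D k \<le> card J \<and> indep_mod (Q (m - k)) J v \<and>
      (\<forall>j\<in>J. Poly_Mapping.keys (v j) \<subseteq> exponent_box (K * D))" if "k \<le> m" for k
    using that
  proof (induction k)
    case 0
    show ?case
    proof (intro exI[of _ 1] allI)
      fix D
      let ?J = "{m \<in> exponent_box D. degree_on F m = 0}"
      have fin: "finite ?J" by (simp add: card_exponent_box(1))
      obtain e where e: "bij_betw e {0..<card ?J} ?J" using ex_bij_betw_nat_finite[OF fin] by blast
      have "indep_mod (Q (m - 0)) {0..<card ?J} (monomial \<circ> e)"
        using indep_mod_reindex[OF e indep_mod_monomials] top by simp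
      moreover have "\<forall>j\<in>{0..<card ?J}. Poly_Mapping.keys ((monomial \<circ> e) j :: ('n, 'k) mpoly) \<subseteq> exponent_box (1 * D)"
        using bij_betwE[OF e] by auto
      moreover have "?N D 0 \<le> card {0..<card ?J}" using card_box_monomials_ge[of D F] by simp
      ultimately show "\<exists>(J :: nat set) v. finite J \<and> ?N D 0 \<le> card J \<and> indep_mod (Q (m - 0)) J v \<and>
        (\<forall>j\<in>J. Poly_Mapping.keys (v j) \<subseteq> exponent_box (1 * D))" by blast
    qed
  next
    case (Suc k)
    then obtain K where K: "\<And>D. \<exists>(J :: nat set) v. finite J \<and> ?N D k \<le> card J \<and>
      indep_mod (Q (m - k)) J v \<and> (\<forall>j\<in>J. Poly_Mapping.keys (v j) \<subseteq> exponent_box (K * D))" by auto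
    have step: "Suc (m - Suc k) = m - k" using Suc.prems by simp
    then obtain f where f: "f \<in> Q (m - k)" "f \<notin> Q (m - Suc k)"
      using chain[of "m - Suc k"] Suc.prems by auto
    have le: "Q (m - Suc k) \<subseteq> Q (m - k)" using chain[of "m - Suc k"] step Suc.prems by auto
    obtain E where E: "Poly_Mapping.keys f \<subseteq> exponent_box E" using keys_subset_exponent_box by blast
    show ?case
    proof (intro exI[of _ "K + E"] allI)
      fix D
      obtain J :: "nat set" and v where J: "finite J" "?N D k \<le> card J" "indep_mod (Q (m - k)) J v"
        "\<And>j. j \<in> J \<Longrightarrow> Poly_Mapping.keys (v j) \<subseteq> exponent_box (K * D)" using K[of D] by blast
      let ?J = "J \<times> {..D}" and ?v = "\<lambda>(j, b). v j * f ^ b"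
      have fin: "finite ?J" using J(1) by simp
      have ind: "indep_mod (Q (m - Suc k)) ?J ?v"
        by (rule indep_mod_powers[OF prime sub le f J(3)]) auto
      have box: "Poly_Mapping.keys (?v x) \<subseteq> exponent_box ((K + E) * D)" if x_J: "x \<in> ?J" for x
      proof -
        obtain j b where x: "x = (j, b)" "j \<in> J" "b \<le> D" using x_J by auto
        have "Poly_Mapping.keys (v j * f ^ b) \<subseteq> exponent_box (K * D + b * E)"
          by (rule keys_mult_exponent_box[OF J(4)[OF x(2)] keys_power_exponent_box[OF E]])
        also have "\<dots> \<subseteq> exponent_box ((K + E) * D)"
          using x(3) by (intro exponent_box_mono) (simp add: algebra_simps)
        finally show ?thesis using x by simp
      qed
      obtain e where e: "bij_betw e {0..<card ?J} ?J" using ex_bij_betw_nat_finite[OF fin] by blast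
      have "indep_mod (Q (m - Suc k)) {0..<card ?J} (?v \<circ> e)"
        by (rule indep_mod_reindex[OF e ind])
      moreover have "\<forall>j\<in>{0..<card ?J}. Poly_Mapping.keys ((?v \<circ> e) j) \<subseteq> exponent_box ((K + E) * D)"
        using bij_betwE[OF e] box by auto
      moreover have "?N D (Suc k) \<le> card {0..<card ?J}"
        using mult_le_mono2[OF J(2), of "D + 1"] by (simp add: card_cartesian_product mult.commute)
      ultimately show "\<exists>(J :: nat set) v. finite J \<and> ?N D (Suc k) \<le> card J \<and>
        indep_mod (Q (m - Suc k)) J v \<and>
        (\<forall>j\<in>J. Poly_Mapping.keys (v j) \<subseteq> exponent_box ((K + E) * D))" by blast
    qed
  qed
  from this[of m] obtain K where K: "\<And>D. \<exists>(J :: nat set) v. finite J \<and> ?N D m \<le> card J \<and>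
      indep_mod (Q 0) J v \<and> (\<forall>j\<in>J. Poly_Mapping.keys (v j) \<subseteq> exponent_box (K * D))" by auto
  show ?thesis
  proof (rule ccontr)
    assume "\<not> m \<le> card F"
    moreover have "card F + card (- F) = CARD('n)"
      using card_Un_disjoint[of F "- F"] by (simp add: Compl_partition)
    ultimately have n: "CARD('n) + 1 \<le> card (- F) + m" by simp
    \<comment> \<open>Chosen so that the upper bound \<open>((K + 1) * (D + 1)) ^ CARD('n)\<close>
      equals \<open>D * (D + 1) ^ CARD('n)\<close>, just short of the lower bound.\<close>
    define D where "D = (K + 1) ^ CARD('n)"
    obtain J :: "nat set" and v where J: "finite J" "?N D m \<le> card J" "indep_mod (Q 0) J v"
        "\<And>j. j \<in> J \<Longrightarrow> Poly_Mapping.keys (v j) \<subseteq> exponent_box (K * D)" using K[of D] by blast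
    have "(D + 1) * (D + 1) ^ CARD('n) \<le> ?N D m"
      using power_increasing[OF n, of "D + 1"] by simp
    also have "\<dots> \<le> (K * D + 1) ^ CARD('n)"
      using J(2) indep_mod_card_le[OF J(1,3) ideal.subspace_0[OF sub] J(4)] by simp
    also have "\<dots> \<le> ((K + 1) * (D + 1)) ^ CARD('n)" by (intro power_mono) auto
    also have "\<dots> = D * (D + 1) ^ CARD('n)" unfolding power_mult_distrib D_def ..
    finally show False by simp
  qed
qed

section \<open>From chains of primes to the height of an intersection\<close>

lemma prime_height_var_ideal_le:
  "prime_height (var_ideal F :: ('n::finite, 'k::field) mpoly set) \<le> enat (card F)"
  unfolding prime_height_def
proof (rule Sup_least, clarify)
  fix m and Q :: "nat \<Rightarrow> ('n, 'k) mpoly set"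
  assume "\<forall>i\<le>m. prime_ideal (Q i)" "\<forall>i<m. Q i \<subset> Q (Suc i)" "Q m = var_ideal F"
  then have "m \<le> card F" by (intro prime_chain_below_var_ideal[of m Q F]) blast+
  then show "enat m \<le> enat (card F)" by simp
qed

lemma card_le_prime_height:
  assumes P: "prime_ideal P" and sub: "(var_ideal F :: ('n::finite, 'k::field) mpoly set) \<subseteq> P"
  shows "enat (card F) \<le> prime_height P"
proof -
  obtain e where e: "bij_betw e {0..<card F} F" using ex_bij_betw_nat_finite[of F] by auto
  \<comment> \<open>Variables of \<open>F\<close> are adjoined one at a time; the last ideal is
    replaced by \<open>P\<close>, which contains it, so the chain stays strict and ends in
    \<open>P\<close>.\<close>
  define Q where "Q i = (if i = card F then P else var_ideal (e ` {0..<i}))" for i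
  have "prime_ideal (Q i)" for i using P by (simp add: Q_def prime_ideal_var_ideal)
  moreover have "Q i \<subset> Q (Suc i)" if i: "i < card F" for i
  proof -
    have "e i \<notin> e ` {0..<i}" using e i by (auto simp: bij_betw_def dest: inj_onD)
    then have "\<not> e ` {0..<Suc i} \<subseteq> e ` {0..<i}" by force
    then have "(var_ideal (e ` {0..<i}) :: ('n, 'k) mpoly set) \<subset> var_ideal (e ` {0..<Suc i})"
      unfolding psubset_eq using var_ideal_subset_iff by (metis image_mono atLeastLessThan_iff less_Suc_eq subsetI order_refl)
    moreover have "var_ideal (e ` {0..<Suc i}) \<subseteq> Q (Suc i)"
      using e sub by (auto simp: Q_def bij_betw_def)
    ultimately show ?thesis using i by (simp add: Q_def)
  qed
  moreover have "Q (card F) = P" by (simp add: Q_def)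
  ultimately show ?thesis unfolding prime_height_def by (intro Sup_upper) blast
qed

text \<open>Every prime over the intersection contains one of the finitely many
  \<open>var_ideal F\<close>, all of height \<open>d\<close>.\<close>

lemma ideal_height_Inter_var_ideals:
  assumes "S \<noteq> {}" and card: "\<And>F. F \<in> S \<Longrightarrow> card F = d"
  shows "ideal_height (\<Inter>F\<in>S. var_ideal F :: ('n::finite, 'k::field) mpoly set) = enat d"
proof (rule antisym)
  obtain F where F: "F \<in> S" using assms(1) by blast
  have "ideal_height (\<Inter>F\<in>S. var_ideal F :: ('n, 'k) mpoly set) \<le> prime_height (var_ideal F :: ('n, 'k) mpoly set)"
    unfolding ideal_height_def using F prime_ideal_var_ideal by (intro Inf_lower) blast
  also have "\<dots> \<le> enat d" using prime_height_var_ideal_le card[OF F] by metis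
  finally show "ideal_height (\<Inter>F\<in>S. var_ideal F :: ('n, 'k) mpoly set) \<le> enat d" .
  show "enat d \<le> ideal_height (\<Inter>F\<in>S. var_ideal F :: ('n, 'k) mpoly set)"
    unfolding ideal_height_def
  proof (rule Inf_greatest, clarify)
    fix P :: "('n, 'k) mpoly set" assume P: "prime_ideal P" "(\<Inter>F\<in>S. var_ideal F) \<subseteq> P"
    obtain F where "F \<in> S" "(var_ideal F :: ('n, 'k) mpoly set) \<subseteq> P"
      using prime_ideal_contains_factor[OF P(1) _ _ P(2)] by (auto simp: var_ideal_def)
    then show "enat d \<le> prime_height P" using card_le_prime_height[OF P(1)] card by metis
  qed
qed

section \<open>Initial degrees\<close>

text \<open>Infinitely many \<open>a\<close> qualify, as values outside \<open>{1..c}\<close> are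
  free, but \<open>a h \<le> h * a h \<le> l\<close> inside bounds the sums. This gives
  \<open>Min\<close> its meaning.\<close>

lemma finite_partition_sums:
  fixes s :: "nat \<Rightarrow> nat"
  shows "finite {\<Sum>h=1..c. a h * s h | a :: nat \<Rightarrow> nat. (\<Sum>h=1..c. h * a h) = l}"
proof (rule finite_subset)
  show "{\<Sum>h=1..c. a h * s h | a :: nat \<Rightarrow> nat. (\<Sum>h=1..c. h * a h) = l} \<subseteq> {..\<Sum>h=1..c. l * s h}"
  proof clarify
    fix a :: "nat \<Rightarrow> nat"
    have "a h \<le> (\<Sum>h=1..c. h * a h)" if "h \<in> {1..c}" for h
    proof -
      have "1 * a h \<le> h * a h" using that by (intro mult_le_mono1) simp
      also have "\<dots> \<le> (\<Sum>h=1..c. h * a h)" using that by (intro member_le_sum) auto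
      finally show ?thesis by simp
    qed
    then show "(\<Sum>h=1..c. a h * s h) \<le> (\<Sum>h=1..c. (\<Sum>h=1..c. h * a h) * s h)"
      by (intro sum_mono mult_le_mono1)
  qed
qed simp

lemma partition_sums_nonempty:
  fixes s :: "nat \<Rightarrow> nat"
  assumes "1 \<le> c"
  shows "{\<Sum>h=1..c. a h * s h | a :: nat \<Rightarrow> nat. (\<Sum>h=1..c. h * a h) = l} \<noteq> {}"
proof -
  have "(\<Sum>h=1..c. h * (if h = 1 then l else 0)) = (\<Sum>h=1..c. if h = 1 then l else 0)"
    by (intro sum.cong) auto
  also have "\<dots> = l" using assms by simp
  finally have "(\<Sum>h=1..c. (if h = 1 then l else 0) * s h)
      \<in> {\<Sum>h=1..c. a h * s h | a :: nat \<Rightarrow> nat. (\<Sum>h=1..c. h * a h) = l}"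
    by (intro CollectI exI[of _ "\<lambda>h. if h = 1 then l else 0"] conjI refl)
  then show ?thesis by (metis empty_iff)
qed

text \<open>The reindexing of \<open>h\<close> as \<open>c - h\<close> turns nullities, as in (1),
  into ranks of dual flats, as in (2).\<close>

lemma partition_sums_reflect:
  fixes s :: "nat \<Rightarrow> nat"
  shows "{\<Sum>h=0..<c. a h * s (c - h) | a :: nat \<Rightarrow> nat. (\<Sum>h=0..<c. (c - h) * a h) = l}
    = {\<Sum>h=1..c. a h * s h | a :: nat \<Rightarrow> nat. (\<Sum>h=1..c. h * a h) = l}" (is "?L = ?R")
proof -
  have reflect: "(\<Sum>h=1..c. g h) = (\<Sum>h=0..<c. g (c - h))" for g :: "nat \<Rightarrow> nat"
    by (rule sum.reindex_bij_witness[of _ "\<lambda>h. c - h" "\<lambda>h. c - h"]) auto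
  show ?thesis
  proof (intro equalityI subsetI)
    fix x assume "x \<in> ?L"
    then obtain a where a: "x = (\<Sum>h=0..<c. a h * s (c - h))" "(\<Sum>h=0..<c. (c - h) * a h) = l"
      by blast
    have "(\<Sum>h=1..c. a (c - h) * s h) = x" "(\<Sum>h=1..c. h * a (c - h)) = l"
      unfolding reflect a(1) a(2)[symmetric] by (intro sum.cong; simp)+
    then show "x \<in> ?R" by (intro CollectI exI[of _ "\<lambda>h. a (c - h)"]) simp
  next
    fix x assume "x \<in> ?R"
    then obtain a where a: "x = (\<Sum>h=1..c. a h * s h)" "(\<Sum>h=1..c. h * a h) = l" by blast
    then have "(\<Sum>h=0..<c. a (c - h) * s (c - h)) = x" "(\<Sum>h=0..<c. (c - h) * a (c - h)) = l"
      unfolding reflect by simp_all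
    then show "x \<in> ?L" by (intro CollectI exI[of _ "\<lambda>h. a (c - h)"]) simp
  qed
qed

section \<open>From exponents to initial degrees\<close>

lemma total_degree_monomial:
  "total_degree (monomial m :: ('n::finite, 'k::field) mpoly) = degree_on UNIV m"
  by (simp add: total_degree_def)

lemma degree_le_total_degree:
  fixes f :: "('n::finite, 'k::field) mpoly"
  shows "m \<in> Poly_Mapping.keys f \<Longrightarrow> degree_on UNIV m \<le> total_degree f"
  unfolding total_degree_def by (intro Max_ge) auto

lemma alpha_eqI:
  fixes L :: "('n::finite, 'k::field) mpoly set"
  assumes "monomial m \<in> L" "degree_on UNIV m = d"
    and "\<And>f m. f \<in> L \<Longrightarrow> m \<in> Poly_Mapping.keys f \<Longrightarrow> d \<le> degree_on UNIV m"
  shows "alpha L = d"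
  unfolding alpha_def
proof (rule Least_equality)
  show "\<exists>f\<in>L. f \<noteq> 0 \<and> total_degree f = d"
    using assms(1,2) total_degree_monomial monomial_neq_0 by blast
  fix y assume "\<exists>f\<in>L. f \<noteq> 0 \<and> total_degree f = y"
  then obtain f where f: "f \<in> L" "f \<noteq> 0" "total_degree f = y" by blast
  then obtain m where m: "m \<in> Poly_Mapping.keys f" by (metis equals0I keys_eq_empty)
  from le_trans[OF assms(3)[OF f(1) m] degree_le_total_degree[OF m]] show "d \<le> y"
    by (simp add: f(3))
qed

lemma lookup_Abs_finite [simp]: "Poly_Mapping.lookup (Abs_poly_mapping w :: 'n::finite \<Rightarrow>\<^sub>0 nat) = w"
  by (rule lookup_Abs_poly_mapping) simp

text \<open>Complements of bases form an antichain, so every \<open>var_ideal (- B)\<close> is an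
  associated prime and contributes its own condition.\<close>

lemma symbolic_power_stanley_reisner:
  fixes \<Delta> :: "'n::finite set set"
  shows "symbolic_power (stanley_reisner_ideal \<Delta> :: ('n, 'k::field) mpoly set) l =
    {f. \<forall>m\<in>Poly_Mapping.keys f. \<forall>B\<in>bases \<Delta>. l \<le> degree_on (- B) m}"
proof -
  have "Ass_quotient (\<Inter>B\<in>bases \<Delta>. var_ideal (- B) :: ('n, 'k) mpoly set) = (\<lambda>B. var_ideal (- B)) ` bases \<Delta>"
    by (rule Ass_quotient_Inter_primes) (auto simp: prime_ideal_var_ideal var_ideal_subset_iff bases_def)
  then show ?thesis
    by (auto simp: symbolic_power_def stanley_reisner_ideal_def ideal_power_var_ideal degree_on_ideal_def)
qed

lemma alpha_symbolic_power:
  fixes \<Delta> :: "'n::finite set set"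
  assumes M: "matroid \<Delta>" and c: "c = nullity \<Delta> UNIV" "1 \<le> c"
  shows "alpha (symbolic_power (stanley_reisner_ideal \<Delta> :: ('n, 'k::field) mpoly set) l) =
    Min {\<Sum>h=1..c. a h * min_nullity_size \<Delta> h | a :: nat \<Rightarrow> nat. (\<Sum>h=1..c. h * a h) = l}"
    (is "_ = Min ?S")
proof -
  have "Min ?S \<in> ?S" using finite_partition_sums partition_sums_nonempty[OF c(2)] by (rule Min_in)
  then obtain a where a: "Min ?S = (\<Sum>h=1..c. a h * min_nullity_size \<Delta> h)" "(\<Sum>h=1..c. h * a h) = l"
    by blast
  obtain w where w: "\<And>B. B \<in> bases \<Delta> \<Longrightarrow> (\<Sum>h=1..c. h * a h) \<le> sum w (- B)"
    "sum w UNIV = (\<Sum>h=1..c. a h * min_nullity_size \<Delta> h)"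
    using weight_upper_bound[OF M, of a] c(1) by metis
  show ?thesis
  proof (rule alpha_eqI)
    show "monomial (Abs_poly_mapping w) \<in> symbolic_power (stanley_reisner_ideal \<Delta> :: ('n, 'k) mpoly set) l"
      using w(1) a(2) by (simp add: symbolic_power_stanley_reisner)
    show "degree_on UNIV (Abs_poly_mapping w) = Min ?S" using w(2) a(1) by simp
    fix f :: "('n, 'k) mpoly" and m
    assume "f \<in> symbolic_power (stanley_reisner_ideal \<Delta>) l" "m \<in> Poly_Mapping.keys f"
    then have "l \<le> degree_on (- B) m" if "B \<in> bases \<Delta>" for B
      using that by (simp add: symbolic_power_stanley_reisner)
    from weight_lower_bound[OF M this] obtain b where b: "(\<Sum>h=1..c. h * b h) = l"
      "(\<Sum>h=1..c. b h * min_nullity_size \<Delta> h) \<le> degree_on UNIV m" using c(1) by blast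
    have "Min ?S \<le> (\<Sum>h=1..c. b h * min_nullity_size \<Delta> h)"
      using b(1) by (intro Min_le finite_partition_sums) blast
    with b(2) show "Min ?S \<le> degree_on UNIV m" by (rule le_trans[rotated])
  qed
qed

text \<open>A squarefree monomial is the indicator of a set, and it lies in the symbolic power
  exactly when that set has nullity at least \<open>l\<close>.\<close>

lemma alpha_SF:
  fixes \<Delta> :: "'n::finite set set"
  assumes M: "matroid \<Delta>" and l: "l \<le> nullity \<Delta> UNIV"
  shows "alpha (SF l (stanley_reisner_ideal \<Delta> :: ('n, 'k::field) mpoly set)) = min_nullity_size \<Delta> l"
proof -
  let ?I = "symbolic_power (stanley_reisner_ideal \<Delta> :: ('n, 'k) mpoly set) l"
  obtain U where U: "nullity \<Delta> U = l" "card U = min_nullity_size \<Delta> l"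
    using min_nullity_size_witness[OF M l] .
  define w where "w i = (if i \<in> U then 1 else 0 :: nat)" for i
  have w: "sum w A = card (U \<inter> A)" for A by (simp add: w_def sum.If_cases Int_commute)
  have "l \<le> sum w (- B)" if "B \<in> bases \<Delta>" for B
    using nullity_le_card_Diff_basis[OF M that, of U] U(1) by (simp add: w Diff_eq)
  then have "monomial (Abs_poly_mapping w) \<in> {f \<in> ?I. squarefree_monomial f}"
    by (auto simp: symbolic_power_stanley_reisner squarefree_monomial_def w_def intro!: exI[of _ "Abs_poly_mapping w"])
  then have "monomial (Abs_poly_mapping w) \<in> SF l (stanley_reisner_ideal \<Delta> :: ('n, 'k) mpoly set)"
    unfolding SF_def by (rule ideal.span_base)
  moreover have "degree_on UNIV (Abs_poly_mapping w) = min_nullity_size \<Delta> l" using U(2) by (simp add: w)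
  moreover have "min_nullity_size \<Delta> l \<le> degree_on UNIV m"
    if "f \<in> SF l (stanley_reisner_ideal \<Delta> :: ('n, 'k) mpoly set)" "m \<in> Poly_Mapping.keys f" for f m
  proof -
    \<comment> \<open>The degree bound on the generators passes to all of \<open>SF\<close> because
      it cuts out an ideal.\<close>
    let ?J = "{f :: ('n, 'k) mpoly. \<forall>m\<in>Poly_Mapping.keys f. min_nullity_size \<Delta> l \<le> degree_on UNIV m}"
    have "SF l (stanley_reisner_ideal \<Delta> :: ('n, 'k) mpoly set) \<subseteq> ?J"
      unfolding SF_def
    proof (rule ideal.span_minimal)
      show "ideal.subspace ?J" by (rule subspace_keys) (simp add: degree_on_add)
      show "{f \<in> ?I. squarefree_monomial f} \<subseteq> ?J"
      proof clarify
        fix f :: "('n, 'k) mpoly" and m'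
        assume f: "f \<in> ?I" "squarefree_monomial f" "m' \<in> Poly_Mapping.keys f"
        then obtain m where m: "f = monomial m" "\<And>i. Poly_Mapping.lookup m i \<le> 1"
          by (auto simp: squarefree_monomial_def)
        define V where "V = {i. Poly_Mapping.lookup m i = 1}"
        have lookup: "Poly_Mapping.lookup m i = (if i \<in> V then 1 else 0)" for i
          using m(2)[of i] by (auto simp: V_def)
        have deg: "degree_on A m = card (V \<inter> A)" for A
          by (simp add: lookup sum.If_cases Int_commute)
        obtain B where B: "B \<in> bases \<Delta>" "card (V \<inter> B) = matroid_rank \<Delta> V"
          using basis_rank_witness[OF M] .
        have "l \<le> card (V - B)"
          using f(1) m(1) B(1) by (simp add: symbolic_power_stanley_reisner deg Diff_eq)
        then have "l \<le> nullity \<Delta> V" by (simp add: nullity_def card_Diff_basis B(2))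
        from min_nullity_size_le[OF this] f(3) m(1) show "min_nullity_size \<Delta> l \<le> degree_on UNIV m'"
          by (simp add: deg)
      qed
    qed
    with that show ?thesis by blast
  qed
  ultimately show ?thesis by (rule alpha_eqI)
qed

text \<open>Each part costs at least \<open>\<mu>\<close> per unit, so \<open>A l\<close> is at
  least \<open>\<mu> * l\<close>. Using a best part \<open>k\<close> as often as it fits and filling
  up with parts \<open>1\<close> exceeds this by a constant only.\<close>

lemma partition_sums_limit:
  fixes s A :: "nat \<Rightarrow> nat"
  assumes c: "1 \<le> c"
    and A: "\<And>l. A l = Min {\<Sum>h=1..c. a h * s h | a :: nat \<Rightarrow> nat. (\<Sum>h=1..c. h * a h) = l}"
  shows "(\<lambda>l. real (A l) / real l) \<longlonglongrightarrow> Min ((\<lambda>h. real (s h) / real h) ` {1..c})"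
proof -
  define \<mu> where "\<mu> = Min ((\<lambda>h. real (s h) / real h) ` {1..c})"
  have "\<mu> \<in> (\<lambda>h. real (s h) / real h) ` {1..c}" unfolding \<mu>_def using c by (intro Min_in) auto
  then obtain k where k: "1 \<le> k" "k \<le> c" "\<mu> = real (s k) / real k" by auto
  have le: "\<mu> * real h \<le> real (s h)" if "h \<in> {1..c}" for h
  proof -
    have "\<mu> \<le> real (s h) / real h" unfolding \<mu>_def using that by (intro Min_le) auto
    then show ?thesis using that by (simp add: pos_le_divide_eq)
  qed
  have lower: "\<mu> * real l \<le> real (A l)" for l
  proof -
    have "A l \<in> {\<Sum>h=1..c. a h * s h | a :: nat \<Rightarrow> nat. (\<Sum>h=1..c. h * a h) = l}"
      unfolding A using finite_partition_sums partition_sums_nonempty[OF c] by (rule Min_in)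
    then obtain a where a: "A l = (\<Sum>h=1..c. a h * s h)" "(\<Sum>h=1..c. h * a h) = l" by blast
    have "\<mu> * real l = (\<Sum>h=1..c. \<mu> * (real h * real (a h)))"
      by (simp add: sum_distrib_left flip: a(2))
    also have "\<dots> = (\<Sum>h=1..c. real (a h) * (\<mu> * real h))"
      by (intro sum.cong) (simp_all only: mult_ac)
    also have "\<dots> \<le> (\<Sum>h=1..c. real (a h) * real (s h))"
      by (intro sum_mono mult_left_mono le) auto
    finally show ?thesis by (simp add: a(1))
  qed
  have upper: "real (A l) \<le> \<mu> * real l + real k * real (s 1)" for l
  proof -
    \<comment> \<open>Division of \<open>l\<close> by \<open>k\<close> with remainder; the two
      summands are added, so that \<open>k = 1\<close> needs no separate case.\<close>
    define a where "a h = (if h = k then l div k else 0) + (if h = 1 then l mod k else 0)" for h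
    have "(\<Sum>h=1..c. h * a h) = (\<Sum>h=1..c. (if h = k then k * (l div k) else 0) + (if h = 1 then l mod k else 0))"
      by (intro sum.cong) (auto simp: a_def)
    also have "\<dots> = l" using k c by (simp add: sum.distrib)
    finally have "A l \<le> (\<Sum>h=1..c. a h * s h)"
      unfolding A by (intro Min_le finite_partition_sums) blast
    also have "\<dots> = (\<Sum>h=1..c. (if h = k then l div k * s k else 0) + (if h = 1 then l mod k * s 1 else 0))"
      by (intro sum.cong) (auto simp: a_def)
    also have "\<dots> = l div k * s k + l mod k * s 1" using k c by (simp add: sum.distrib)
    also have "\<dots> \<le> l div k * s k + k * s 1"
      using k(1) mod_less_divisor[of k l] by (intro add_left_mono mult_le_mono1) simp
    finally have "real (A l) \<le> real (l div k) * real (s k) + real k * real (s 1)"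
      by (simp flip: of_nat_mult of_nat_add)
    also have "real (l div k) * real (s k) \<le> real l / real k * real (s k)"
      by (intro mult_right_mono of_nat_div_le_of_nat) simp
    finally show ?thesis by (simp add: k(3) ac_simps)
  qed
  show ?thesis
    unfolding \<mu>_def[symmetric]
  proof (rule tendsto_sandwich)
    show "\<forall>\<^sub>F l in sequentially. \<mu> \<le> real (A l) / real l"
      using eventually_gt_at_top[of 0] by eventually_elim (use lower in \<open>simp add: pos_le_divide_eq\<close>)
    show "\<forall>\<^sub>F l in sequentially. real (A l) / real l \<le> \<mu> + real k * real (s 1) / real l"
      using eventually_gt_at_top[of 0]
    proof eventually_elim
      case (elim l)
      have "real (A l) / real l \<le> (\<mu> * real l + real k * real (s 1)) / real l"
        by (intro divide_right_mono upper) simp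
      also have "\<dots> = \<mu> + real k * real (s 1) / real l" using elim by (simp add: add_divide_distrib)
      finally show ?case .
    qed
    have "(\<lambda>l. \<mu> + real k * real (s 1) / real l) \<longlonglongrightarrow> \<mu> + 0"
      by (intro tendsto_add tendsto_const lim_const_over_n)
    then show "(\<lambda>l. \<mu> + real k * real (s 1) / real l) \<longlonglongrightarrow> \<mu>" by simp
  qed simp
qed

section \<open>The Waldschmidt constant of a matroidal ideal\<close>

lemma cover_ideal_dual_matroid:
  "matroid \<Delta> \<Longrightarrow> cover_ideal (dual_matroid \<Delta>) = stanley_reisner_ideal \<Delta>"
  by (simp add: cover_ideal_def stanley_reisner_ideal_def bases_dual_matroid)

lemma ideal_height_stanley_reisner:
  fixes \<Delta> :: "'n::finite set set"
  assumes M: "matroid \<Delta>"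
  shows "ideal_height (stanley_reisner_ideal \<Delta> :: ('n, 'k::field) mpoly set) = enat (nullity \<Delta> UNIV)"
proof -
  have "card F = nullity \<Delta> UNIV" if "F \<in> uminus ` bases \<Delta>" for F
    using that by (auto simp: bases_iff[OF M] nullity_UNIV Compl_eq_Diff_UNIV card_Diff_subset)
  moreover have "uminus ` bases \<Delta> \<noteq> {}" using basis_rank_witness[OF M] by blast
  ultimately have "ideal_height (\<Inter>F\<in>uminus ` bases \<Delta>. var_ideal F :: ('n, 'k) mpoly set) = enat (nullity \<Delta> UNIV)"
    by (intro ideal_height_Inter_var_ideals)
  then show ?thesis by (simp add: stanley_reisner_ideal_def)
qed

text \<open>Nullity zero makes the ground set the only basis, and \<open>var_ideal {}\<close> is
  zero. Positivity keeps the minima over \<open>{1..c}\<close> from being empty.\<close>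

lemma nullity_UNIV_pos:
  fixes \<Delta> :: "'n::finite set set"
  assumes M: "matroid \<Delta>" and nz: "(stanley_reisner_ideal \<Delta> :: ('n, 'k::field) mpoly set) \<noteq> {0}"
  shows "1 \<le> nullity \<Delta> UNIV"
proof (rule ccontr)
  assume "\<not> 1 \<le> nullity \<Delta> UNIV"
  then have "matroid_rank \<Delta> UNIV = CARD('n)"
    using matroid_rank_le_card[OF M, of UNIV] by (simp add: nullity_UNIV)
  then have "bases \<Delta> \<subseteq> {UNIV}"
    using card_eq_UNIV_imp_eq_UNIV[where 'a='n, OF finite] by (simp add: bases_iff[OF M] subset_iff)
  moreover have "bases \<Delta> \<noteq> {}" using basis_rank_witness[OF M] by blast
  ultimately have "bases \<Delta> = {UNIV}" by blast
  then have "(stanley_reisner_ideal \<Delta> :: ('n, 'k) mpoly set) = {0}"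
    by (simp add: stanley_reisner_ideal_def var_ideal_def)
  with nz show False by simp
qed

theorem corollary6p3:
  fixes I :: "('n::finite, 'k::field) mpoly set" and c :: nat
  assumes "C_matroidal I" and "I \<noteq> {0}" and "ideal_height I = enat c"
  shows "convergent (\<lambda>l. real (alpha (symbolic_power I l)) / real l)
    \<and> waldschmidt I = Min ((\<lambda>l. real (alpha (SF l I)) / real l) ` {1..c})
    \<and> (\<forall>\<Delta>. matroid \<Delta> \<and> I = stanley_reisner_ideal \<Delta> \<longrightarrow>
        I = cover_ideal (dual_matroid \<Delta>)
      \<and> (let ch = (\<lambda>h. min_circuit_size (elongation \<Delta> (CARD('n) - c + h - 1))) in
          (\<forall>l\<ge>1. alpha (symbolic_power I l) =
             Min {\<Sum>h=1..c. a h * ch h | a :: nat \<Rightarrow> nat. (\<Sum>h=1..c. h * a h) = l})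
        \<and> waldschmidt I = Min ((\<lambda>h. real (ch h) / real h) ` {1..c}))
      \<and> (let fh = (\<lambda>h. max_flat_size (dual_matroid \<Delta>) h) in
          (\<forall>l\<ge>1. alpha (symbolic_power I l) =
             Min {\<Sum>h=0..<c. a h * (CARD('n) - fh h) | a :: nat \<Rightarrow> nat.
                  (\<Sum>h=0..<c. (c - h) * a h) = l})
        \<and> waldschmidt I =
             Min ((\<lambda>h. (real CARD('n) - real (fh h)) / (real c - real h)) ` {0..<c})))"
proof -
  \<comment> \<open>The height identifies \<open>c\<close> with the nullity for every matroid
    representing \<open>I\<close>, so each formula can be proved for an arbitrary such
    \<open>\<Delta>\<close>.\<close>
  have nullity: "nullity \<Delta> UNIV = c" "1 \<le> c" if "matroid \<Delta>" "I = stanley_reisner_ideal \<Delta>" for \<Delta>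
    using ideal_height_stanley_reisner[OF that(1), where 'k='k] nullity_UNIV_pos[OF that(1), where 'k='k]
      that(2) assms(2,3) by auto
  have limit: "(\<lambda>l. real (alpha (symbolic_power I l)) / real l)
      \<longlonglongrightarrow> Min ((\<lambda>h. real (min_nullity_size \<Delta> h) / real h) ` {1..c})"
    if "matroid \<Delta>" "I = stanley_reisner_ideal \<Delta>" for \<Delta>
    using partition_sums_limit[OF nullity(2)[OF that]
      alpha_symbolic_power[OF that(1) nullity(1)[OF that, symmetric] nullity(2)[OF that], where 'k='k]]
    unfolding that(2) .
  have waldschmidt: "waldschmidt I = Min ((\<lambda>h. real (min_nullity_size \<Delta> h) / real h) ` {1..c})"
    if "matroid \<Delta>" "I = stanley_reisner_ideal \<Delta>" for \<Delta>
    unfolding waldschmidt_def by (rule limI[OF limit[OF that]])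
  obtain \<Delta>0 where \<Delta>0: "matroid \<Delta>0" "I = stanley_reisner_ideal \<Delta>0"
    using assms(1) by (auto simp: C_matroidal_def)
  have "convergent (\<lambda>l. real (alpha (symbolic_power I l)) / real l)"
    using limit[OF \<Delta>0] by (auto simp: convergent_def)
  moreover have "waldschmidt I = Min ((\<lambda>l. real (alpha (SF l I)) / real l) ` {1..c})"
    unfolding waldschmidt[OF \<Delta>0]
    by (intro arg_cong[of _ _ Min] image_cong)
      (simp_all add: \<Delta>0(2) alpha_SF[OF \<Delta>0(1)] nullity(1)[OF \<Delta>0])
  moreover have "I = cover_ideal (dual_matroid \<Delta>)" if "matroid \<Delta>" "I = stanley_reisner_ideal \<Delta>" for \<Delta>
    using that by (simp add: cover_ideal_dual_matroid)
  moreover have "let ch = (\<lambda>h. min_circuit_size (elongation \<Delta> (CARD('n) - c + h - 1))) in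
          (\<forall>l\<ge>1. alpha (symbolic_power I l) =
             Min {\<Sum>h=1..c. a h * ch h | a :: nat \<Rightarrow> nat. (\<Sum>h=1..c. h * a h) = l})
        \<and> waldschmidt I = Min ((\<lambda>h. real (ch h) / real h) ` {1..c})"
    if \<Delta>: "matroid \<Delta>" "I = stanley_reisner_ideal \<Delta>" for \<Delta>
  proof -
    define ch where "ch h = min_circuit_size (elongation \<Delta> (CARD('n) - c + h - 1))" for h
    \<comment> \<open>Matches the elongation rank in (1) with the form used by
      \<open>min_circuit_size_elongation\<close>.\<close>
    have "CARD('n) - c = matroid_rank \<Delta> UNIV"
      using nullity(1)[OF \<Delta>] matroid_rank_le_card[OF \<Delta>(1), of UNIV] by (simp add: nullity_UNIV)
    then have ch: "ch h = min_nullity_size \<Delta> h" if "h \<in> {1..c}" for h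
      using min_circuit_size_elongation[OF \<Delta>(1), of h] nullity(1)[OF \<Delta>] that by (simp add: ch_def)
    have "(\<Sum>h=1..c. a h * ch h) = (\<Sum>h=1..c. a h * min_nullity_size \<Delta> h)" for a
      by (intro sum.cong) (simp_all add: ch)
    moreover have "(\<lambda>h. real (ch h) / real h) ` {1..c}
        = (\<lambda>h. real (min_nullity_size \<Delta> h) / real h) ` {1..c}"
      by (intro image_cong) (simp_all add: ch)
    ultimately show ?thesis
      using alpha_symbolic_power[OF \<Delta>(1) nullity(1)[OF \<Delta>, symmetric] nullity(2)[OF \<Delta>], where 'k='k]
      unfolding Let_def ch_def[symmetric] by (simp add: waldschmidt[OF \<Delta>] flip: \<Delta>(2))
  qed
  moreover have "let fh = (\<lambda>h. max_flat_size (dual_matroid \<Delta>) h) in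
          (\<forall>l\<ge>1. alpha (symbolic_power I l) =
             Min {\<Sum>h=0..<c. a h * (CARD('n) - fh h) | a :: nat \<Rightarrow> nat.
                  (\<Sum>h=0..<c. (c - h) * a h) = l})
        \<and> waldschmidt I =
             Min ((\<lambda>h. (real CARD('n) - real (fh h)) / (real c - real h)) ` {0..<c})"
    if \<Delta>: "matroid \<Delta>" "I = stanley_reisner_ideal \<Delta>" for \<Delta>
  proof -
    define fh where "fh h = max_flat_size (dual_matroid \<Delta>) h" for h
    have fh: "fh h + min_nullity_size \<Delta> (c - h) = CARD('n)" if "h \<in> {0..<c}" for h
      using max_flat_size_dual[OF \<Delta>(1), of "c - h"] nullity(1)[OF \<Delta>] that by (simp add: fh_def)
    then have fh_nat: "CARD('n) - fh h = min_nullity_size \<Delta> (c - h)"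
      and fh_real: "real CARD('n) - real (fh h) = real (min_nullity_size \<Delta> (c - h))"
      if "h \<in> {0..<c}" for h
      using that by (metis add_diff_cancel_left', metis add_diff_cancel_left' of_nat_add)
    have "(\<Sum>h=0..<c. a h * (CARD('n) - fh h)) = (\<Sum>h=0..<c. a h * min_nullity_size \<Delta> (c - h))" for a
      by (intro sum.cong) (simp_all add: fh_nat)
    moreover have "(\<lambda>h. (real CARD('n) - real (fh h)) / (real c - real h)) ` {0..<c}
        = (\<lambda>h. real (min_nullity_size \<Delta> h) / real h) ` {1..c}" (is "?L = ?R")
    proof -
      \<comment> \<open>Here \<open>h < c\<close>, so the real differences agree with the truncated
        ones.\<close>
      have "?L = (\<lambda>h. real (min_nullity_size \<Delta> (c - h)) / real (c - h)) ` {0..<c}"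
        by (intro image_cong) (simp_all add: fh_real of_nat_diff)
      also have "\<dots> = (\<lambda>h. real (min_nullity_size \<Delta> h) / real h) ` ((\<lambda>h. c - h) ` {0..<c})"
        by (simp only: image_image)
      also have "(\<lambda>h. c - h) ` {0..<c} = {1..c}"
        by (rule bij_betw_imp_surj_on[OF bij_betw_byWitness[where f' = "\<lambda>h. c - h"]]) auto
      finally show ?thesis .
    qed
    ultimately show ?thesis
      using alpha_symbolic_power[OF \<Delta>(1) nullity(1)[OF \<Delta>, symmetric] nullity(2)[OF \<Delta>], where 'k='k]
      unfolding Let_def fh_def[symmetric] by (simp add: waldschmidt[OF \<Delta>] partition_sums_reflect flip: \<Delta>(2))
  qed
  ultimately show ?thesis by blast
qed

end
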